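(* Let $F\colon X\to Y\cup\{+\infty_Y\}$ be proper and $K$-convex, $G\colon X\to Z\cup\{+\infty_Z\}$ proper and $S$-convex, $C\subset X$ nonempty and convex, $A:=C\cap G^{-1}(-S)$, and assume $A\cap\operatorname{dom}F\neq\emptyset$. Consider the conditions $(C_1)$ there is $x_1\in C\cap\operatorname{dom}F$ with $G(x_1)\in-\operatorname{int}S$; $(C_2)$ there is $x_2\in C\cap\operatorname{dom}G$ such that $F$ is continuous at $x_2$; $(C_3)$ there is $x_3\in C$ such that $G$ is continuous at $x_3$. Say that stable strong duality holds for the pair $(\mathrm{VP})$–$(\mathrm{VD}_i)$ if $\operatorname{WInf}\{F(x)-L(x): x\in C,\ G(x)\in-S\}=\operatorname{WMax}N_i^L$ for every $L\in\mathcal{L}(X,Y)$, with $N_i^L$ ($i=1,2,3$) as in the context. Then: (i) If $(C_1)$ holds, then stable strong duality holds for $(\mathrm{VP})$–$(\mathrm{VD}_1)$. (ii) If $(C_1)$ and $(C_2)$ hold, then stable strong duality holds for $(\mathrm{VP})$–$(\mathrm{VD}_1)$ and $(\mathrm{VP})$–$(\mathrm{VD}_2)$. (iii) If $(C_1)$, $(C_2)$ and $(C_3)$ hold, then stable strong duality holds for the three pairs $(\mathrm{VP})$–$(\mathrm{VD}_i)$, $i=1,2,3$.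
   Context: **Spaces and order.** $X,Y,Z$ are locally convex Hausdorff topological vector spaces; $K\subset Y$ is a proper ($K\ne Y$) closed convex cone with $\operatorname{int}K\neq\emptyset$; $S\subset Z$ is a nonempty closed convex cone. In $Y$: $y_1<_K y_2$ iff $y_1-y_2\in-\operatorname{int}K$, and $y_1\leqq_K y_2$ iff $y_1-y_2\in-K$. $Y^\bullet:=Y\cup\{-\infty_Y,+\infty_Y\}$ with $-\infty_Y<_K y<_K+\infty_Y$ for all $y\in Y$ (and $-\infty_Y<_K+\infty_Y$). Conventions: $-(\pm\infty_Y)=\mp\infty_Y$; $(+\infty_Y)+y=+\infty_Y$ for $y\in Y\cup\{+\infty_Y\}$; $(-\infty_Y)+y=-\infty_Y$ for $y\in Y\cup\{-\infty_Y\}$; sums of sets are elementwise. **Weak suprema/infima.** For $M\subset Y^\bullet$, $\operatorname{WSup}M$ is the set of $\bar v\in Y^\bullet$ such that $\bar v\not<_K v$ for all $v\in M$ and, for every $\tilde v\in Y^\bullet$ with $\tilde v<_K\bar v$, there is $v\in M$ with $\tilde v<_K v$. $\operatorname{WInf}M$ is the set of $\bar v\in Y^\bullet$ such that $v\not<_K\bar v$ for all $v\in M$ and, for every $\tilde v\in Y^\bullet$ with $\bar v<_K\tilde v$, there is $v\in M$ with $v<_K\tilde v$. $\operatorname{WMax}M:=M\cap\operatorname{WSup}M$. **WS-sum.** $\mathcal{P}_p(Y)$ is the collection of all $U\subset Y$ such that $Y=(U-\operatorname{int}K)\cup U\cup(U+\operatorname{int}K)$ with the three sets pairwise disjoint.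 For $U,V\in\mathcal{P}_p(Y)\cup\{\{+\infty_Y\}\}$, $U\uplus V:=\operatorname{WSup}(U+V)$, which again lies in $\mathcal{P}_p(Y)\cup\{\{+\infty_Y\}\}$; $\uplus$ is associative and commutative. **Mappings.** For $H\colon X\to Y\cup\{+\infty_Y\}$, $\operatorname{dom}H=\{x: H(x)\neq+\infty_Y\}$; $H$ is proper if $\operatorname{dom}H\ne\emptyset$; $H$ is $K$-convex if $\{(x,y)\in X\times Y: H(x)\leqq_K y\}$ is convex. The same definitions are used for $G$ with $Z,S$ in place of $Y,K$. A mapping is continuous at $x$ if its value at $x$ is finite (in $Y$, resp. $Z$) and every neighbourhood of this value contains the image of some neighbourhood of $x$. $I_D(x)=0_Y$ if $x\in D$, $+\infty_Y$ otherwise. $\mathcal{L}(X,Y)$ is the space of continuous linear mappings $X\to Y$, and $\mathcal{L}_+(S,K):=\{T\in\mathcal{L}(Z,Y): T(S)\subset K\}$. $(T\circ G)(x):=+\infty_Y$ when $G(x)=+\infty_Z$. The conjugate of $H$ is $H^*(L):=\operatorname{WSup}\{L(x)-H(x): x\in X\}$, $L\in\mathcal{L}(X,Y)$. **Problems.** $(\mathrm{VP})$ is $\operatorname{WInf}\{F(x):x\in C,\ G(x)\in-S\}$; $(\mathrm{VP}^L)$ is the same problem with $F$ replaced by $F-L$. The duals of $(\mathrm{VP}^L)$ are $(\mathrm{VD}_i^L)$: $\operatorname{WSup}N_i^L$ ($(\mathrm{VD}_i)$ being the case $L=0$), where $$N_1^L:=\bigcup_{T\in\mathcal{L}_+(S,K)}\operatorname{WInf}\{F(x)-L(x)+(T\circ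 G)(x):x\in C\}=\bigcup_{T\in\mathcal{L}_+(S,K)}-(F-L+I_C+T\circ G)^*(0),$$ $$N_2^L:=\bigcup_{L'\in\mathcal{L}(X,Y),\,T\in\mathcal{L}_+(S,K)}-\big[(F-L)^*(L')\uplus(I_C+T\circ G)^*(-L')\big],$$ $$N_3^L:=\bigcup_{L',L''\in\mathcal{L}(X,Y),\,T\in\mathcal{L}_+(S,K)}-\big[(F-L)^*(L')\uplus I_C^*(L'')\uplus(T\circ G)^*(-L'-L'')\big].$$ *)

theory Defs
  imports "HOL-Analysis.Analysis" "HOL-Library.Extended"
begin

text \<open>Convexity is unfolded here because \<^const>\<open>convex\<close> cannot be used inside a class specification.\<close>

class locally_convex_space = real_vector + t2_space + topological_ab_group_add +
  assumes tendsto_scaleR_Pair: "LIM x (nhds a \<times>\<^sub>F nhds b). fst x *\<^sub>R snd x :> nhds (a *\<^sub>R b)"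
    and locally_convex_unfolded: "open U \<Longrightarrow> 0 \<in> U \<Longrightarrow>
      \<exists>V. open V \<and> 0 \<in> V \<and> V \<subseteq> U \<and>
        (\<forall>x\<in>V. \<forall>y\<in>V. \<forall>u\<ge>0. \<forall>v\<ge>0. u + v = 1 \<longrightarrow> u *\<^sub>R x + v *\<^sub>R y \<in> V)"

lemma locally_convex:
  fixes U :: "'a::locally_convex_space set"
  assumes "open U" "0 \<in> U"
  shows "\<exists>V. open V \<and> convex V \<and> 0 \<in> V \<and> V \<subseteq> U"
  using locally_convex_unfolded[OF assms] unfolding convex_def by blast

definition cont_linear :: "('a::locally_convex_space \<Rightarrow> 'b::locally_convex_space) set"
  where "cont_linear = {L. linear L \<and> continuous_on UNIV L}"

definition pos_cont_linear ::
    "'c::locally_convex_space set \<Rightarrow> 'b::locally_convex_space set \<Rightarrow> ('c \<Rightarrow> 'b) set"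
  where "pos_cont_linear S K = {T \<in> cont_linear. T ` S \<subseteq> K}"

text \<open>
  The extension of a space by two infinite elements is \<^typ>\<open>'a extended\<close>. Its library addition also
  fixes a value for \<^term>\<open>Pinf + Minf\<close>, which is left undefined in the theory of weak suprema;
  that sum does not occur below for mappings that avoid \<^term>\<open>Minf\<close> and are proper where conjugated.
  The library order on \<^typ>\<open>'a extended\<close> is not used; the order is the one induced by a cone.
\<close>

fun cone_less :: "'b::locally_convex_space set \<Rightarrow> 'b extended \<Rightarrow> 'b extended \<Rightarrow> bool"
  where
    "cone_less K (Fin u) (Fin v) \<longleftrightarrow> u - v \<in> uminus ` interior K"
  | "cone_less K (Fin u) Pinf \<longleftrightarrow> True"
  | "cone_less K Minf (Fin v) \<longleftrightarrow> True"
  | "cone_less K Minf Pinf \<longleftrightarrow> True"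
  | "cone_less K Pinf v \<longleftrightarrow> False"
  | "cone_less K u Minf \<longleftrightarrow> False"

definition WSup :: "'b::locally_convex_space set \<Rightarrow> 'b extended set \<Rightarrow> 'b extended set"
  where "WSup K M = {v. (\<forall>w\<in>M. \<not> cone_less K v w) \<and>
                        (\<forall>u. cone_less K u v \<longrightarrow> (\<exists>w\<in>M. cone_less K u w))}"

definition WInf :: "'b::locally_convex_space set \<Rightarrow> 'b extended set \<Rightarrow> 'b extended set"
  where "WInf K M = {v. (\<forall>w\<in>M. \<not> cone_less K w v) \<and>
                        (\<forall>u. cone_less K v u \<longrightarrow> (\<exists>w\<in>M. cone_less K w u))}"

definition WMax :: "'b::locally_convex_space set \<Rightarrow> 'b extended set \<Rightarrow> 'b extended set"
  where "WMax K M = M \<inter> WSup K M"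

text \<open>
  The WS-sum. It is of interest only for arguments that are either \<^term>\<open>{Pinf}\<close> or a set of finite
  elements partitioning the space, as conjugates of proper mappings are. Addition of sets is
  elementwise.
\<close>

definition WS_sum ::
    "'b::locally_convex_space set \<Rightarrow> 'b extended set \<Rightarrow> 'b extended set \<Rightarrow> 'b extended set"
  where "WS_sum K U V = WSup K (U + V)"

definition effdom :: "('a \<Rightarrow> 'b extended) \<Rightarrow> 'a set"
  where "effdom H = {x. H x \<noteq> Pinf}"

definition proper :: "('a \<Rightarrow> 'b extended) \<Rightarrow> bool"
  where "proper H \<longleftrightarrow> effdom H \<noteq> {}"

definition cone_convex ::
    "'b::locally_convex_space set \<Rightarrow> ('a::locally_convex_space \<Rightarrow> 'b extended) \<Rightarrow> bool"
  where "cone_convex K H \<longleftrightarrow> convex {(x, y). \<exists>h. H x = Fin h \<and> h - y \<in> uminus ` K}"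

definition continuous_at_point ::
    "('a::locally_convex_space \<Rightarrow> 'b::locally_convex_space extended) \<Rightarrow> 'a \<Rightarrow> bool"
  where "continuous_at_point H x \<longleftrightarrow>
    (\<exists>h. H x = Fin h \<and>
      (\<forall>V. open V \<and> h \<in> V \<longrightarrow> (\<exists>U. open U \<and> x \<in> U \<and> H ` U \<subseteq> Fin ` V)))"

definition ind :: "'a set \<Rightarrow> 'a \<Rightarrow> 'b::zero extended"
  where "ind D x = (if x \<in> D then Fin 0 else Pinf)"

definition compose_ext :: "('c \<Rightarrow> 'b) \<Rightarrow> ('a \<Rightarrow> 'c extended) \<Rightarrow> 'a \<Rightarrow> 'b extended"
  where "compose_ext T G x = map_extended T (G x)"

definition tilt :: "('a \<Rightarrow> 'b::ab_group_add extended) \<Rightarrow> ('a \<Rightarrow> 'b) \<Rightarrow> 'a \<Rightarrow> 'b extended"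
  where "tilt F L x = F x - Fin (L x)"

definition conjugate ::
    "'b::locally_convex_space set \<Rightarrow> ('a::locally_convex_space \<Rightarrow> 'b extended) \<Rightarrow> ('a \<Rightarrow> 'b)
      \<Rightarrow> 'b extended set"
  where "conjugate K H L = WSup K {Fin (L x) - H x |x. True}"

definition feasible :: "'c::locally_convex_space set \<Rightarrow> 'a set \<Rightarrow> ('a \<Rightarrow> 'c extended) \<Rightarrow> 'a set"
  where "feasible S C G = {x \<in> C. G x \<in> Fin ` uminus ` S}"

definition dual_set1 ::
    "'b::locally_convex_space set \<Rightarrow> 'c::locally_convex_space set \<Rightarrow> 'a::locally_convex_space set
      \<Rightarrow> ('a \<Rightarrow> 'b extended) \<Rightarrow> ('a \<Rightarrow> 'c extended) \<Rightarrow> ('a \<Rightarrow> 'b) \<Rightarrow> 'b extended set"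
  where "dual_set1 K S C F G L =
    (\<Union>T \<in> pos_cont_linear S K. WInf K {tilt F L x + compose_ext T G x |x. x \<in> C})"

definition dual_set2 ::
    "'b::locally_convex_space set \<Rightarrow> 'c::locally_convex_space set \<Rightarrow> 'a::locally_convex_space set
      \<Rightarrow> ('a \<Rightarrow> 'b extended) \<Rightarrow> ('a \<Rightarrow> 'c extended) \<Rightarrow> ('a \<Rightarrow> 'b) \<Rightarrow> 'b extended set"
  where "dual_set2 K S C F G L =
    (\<Union>L' \<in> cont_linear. \<Union>T \<in> pos_cont_linear S K.
      uminus ` WS_sum K (conjugate K (tilt F L) L')
                        (conjugate K (\<lambda>x. ind C x + compose_ext T G x) (\<lambda>x. - L' x)))"

definition dual_set3 ::
    "'b::locally_convex_space set \<Rightarrow> 'c::locally_convex_space set \<Rightarrow> 'a::locally_convex_space set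
      \<Rightarrow> ('a \<Rightarrow> 'b extended) \<Rightarrow> ('a \<Rightarrow> 'c extended) \<Rightarrow> ('a \<Rightarrow> 'b) \<Rightarrow> 'b extended set"
  where "dual_set3 K S C F G L =
    (\<Union>L' \<in> cont_linear. \<Union>L'' \<in> cont_linear. \<Union>T \<in> pos_cont_linear S K.
      uminus ` WS_sum K (WS_sum K (conjugate K (tilt F L) L') (conjugate K (ind C) L''))
                        (conjugate K (compose_ext T G) (\<lambda>x. - L' x - L'' x)))"

definition stable_strong_duality ::
    "'b::locally_convex_space set \<Rightarrow> 'c::locally_convex_space set \<Rightarrow> 'a::locally_convex_space set
      \<Rightarrow> ('a \<Rightarrow> 'b extended) \<Rightarrow> ('a \<Rightarrow> 'c extended) \<Rightarrow> (('a \<Rightarrow> 'b) \<Rightarrow> 'b extended set) \<Rightarrow> bool"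
  where "stable_strong_duality K S C F G N \<longleftrightarrow>
    (\<forall>L \<in> cont_linear. WInf K {tilt F L x |x. x \<in> feasible S C G} = WMax K (N L))"

definition regularity1 ::
    "'c::locally_convex_space set \<Rightarrow> 'a set \<Rightarrow> ('a \<Rightarrow> 'b extended) \<Rightarrow> ('a \<Rightarrow> 'c extended) \<Rightarrow> bool"
  where "regularity1 S C F G \<longleftrightarrow> (\<exists>x \<in> C \<inter> effdom F. G x \<in> Fin ` uminus ` interior S)"

definition regularity2 ::
    "'a::locally_convex_space set \<Rightarrow> ('a \<Rightarrow> 'b::locally_convex_space extended)
      \<Rightarrow> ('a \<Rightarrow> 'c extended) \<Rightarrow> bool"
  where "regularity2 C F G \<longleftrightarrow> (\<exists>x \<in> C \<inter> effdom G. continuous_at_point F x)"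

definition regularity3 ::
    "'a::locally_convex_space set \<Rightarrow> ('a \<Rightarrow> 'c::locally_convex_space extended) \<Rightarrow> bool"
  where "regularity3 C G \<longleftrightarrow> (\<exists>x \<in> C. continuous_at_point G x)"

lemma uminus_extended_uminus [simp]: "- (- v) = (v :: 'b::group_add extended)"
  by (cases v) auto

lemma Fin_0_diff_extended: "Fin 0 - v = - (v :: 'b::ab_group_add extended)"
  by (cases v) auto

lemma cone_less_uminus: "cone_less K (- u) (- v) \<longleftrightarrow> cone_less K v u"
  by (cases u; cases v) auto

lemma uminus_WSup_uminus: "uminus ` WSup K (uminus ` M) = WInf K M"
proof -
  have less: "cone_less K (- u) v \<longleftrightarrow> cone_less K (- v) u"
             "cone_less K u (- v) \<longleftrightarrow> cone_less K v (- u)" for u v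
    using cone_less_uminus[of K u "- v"] cone_less_uminus[of K "- u" v] by simp_all
  have iff: "- v \<in> WSup K (uminus ` M) \<longleftrightarrow> v \<in> WInf K M" for v
  proof -
    have "(\<forall>u. cone_less K u (- v) \<longrightarrow> (\<exists>w\<in>M. cone_less K u (- w))) \<longleftrightarrow>
          (\<forall>u. cone_less K v u \<longrightarrow> (\<exists>w\<in>M. cone_less K w u))"
      (is "?l \<longleftrightarrow> ?r")
    proof
      assume l: ?l
      show ?r
      proof (intro allI impI)
        fix u assume "cone_less K v u"
        then have "cone_less K (- u) (- v)" by (simp add: cone_less_uminus)
        then show "\<exists>w\<in>M. cone_less K w u" using l cone_less_uminus by blast
      qed
    next
      assume r: ?r
      show ?l
      proof (intro allI impI)
        fix u assume "cone_less K u (- v)"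
        then have "cone_less K v (- u)" using less(2) by blast
        then show "\<exists>w\<in>M. cone_less K u (- w)" using r less(2) by blast
      qed
    qed
    then show ?thesis
      by (simp add: WSup_def WInf_def cone_less_uminus)
  qed
  show ?thesis
  proof (intro equalityI subsetI)
    fix v assume "v \<in> uminus ` WSup K (uminus ` M)"
    then show "v \<in> WInf K M" using iff by (metis imageE uminus_extended_uminus)
  next
    fix v assume "v \<in> WInf K M"
    then show "v \<in> uminus ` WSup K (uminus ` M)"
      using iff[of v] by (intro image_eqI[of _ _ "- v"]) simp_all
  qed
qed

lemma WInf_insert_Pinf: "WInf K (insert Pinf M) = WInf K M"
  by (simp add: WInf_def)

text \<open>The description of the first dual set through conjugates.\<close>

lemma dual_set1_conjugate:
  assumes "\<And>x. F x \<noteq> Minf" "\<And>x. G x \<noteq> Minf"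
  shows "dual_set1 K S C F G L =
    (\<Union>T \<in> pos_cont_linear S K.
      uminus ` conjugate K (\<lambda>x. tilt F L x + ind C x + compose_ext T G x) (\<lambda>_. 0))"
proof -
  have "uminus ` conjugate K (\<lambda>x. tilt F L x + ind C x + compose_ext T G x) (\<lambda>_. 0) =
        WInf K {tilt F L x + compose_ext T G x |x. x \<in> C}" (is "?l = WInf K ?M") for T
  proof -
    let ?h = "\<lambda>x. tilt F L x + ind C x + compose_ext T G x"
    have "{Fin 0 - ?h x |x. True} = uminus ` range ?h"
      unfolding Fin_0_diff_extended by blast
    then have l: "?l = WInf K (range ?h)"
      by (simp add: conjugate_def uminus_WSup_uminus)
    have h: "?h x = (if x \<in> C then tilt F L x + compose_ext T G x else Pinf)" for x
      using assms(1)[of x] assms(2)[of x]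
      by (cases "F x"; cases "G x") (simp_all add: ind_def tilt_def compose_ext_def)
    have "insert Pinf (range ?h) = insert Pinf ?M"
    proof (intro equalityI subsetI)
      fix v assume "v \<in> insert Pinf (range ?h)"
      then show "v \<in> insert Pinf ?M" by (auto simp only: h split: if_splits)
    next
      fix v assume "v \<in> insert Pinf ?M"
      then consider "v = Pinf" | x where "x \<in> C" "v = ?h x" by (auto simp only: h if_True)
      then show "v \<in> insert Pinf (range ?h)" by cases blast+
    qed
    then have "WInf K (range ?h) = WInf K ?M"
      using WInf_insert_Pinf[of K "range ?h"] WInf_insert_Pinf[of K ?M] by (simp only:)
    with l show ?thesis by (simp only:)
  qed
  then show ?thesis
    by (simp add: dual_set1_def)
qed

end

theory Submission
  imports Defs
begin

text \<open>
  The order in \<open>Y\<close> is only partial, but every duality statement is reduced to separation by a single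
  real functional. Let \<open>y\<close> be a finite element of the weak infimum of the primal values
  \<open>F(x) - L(x)\<close>. By definition no feasible value lies strictly below \<open>y\<close>, so the convex set of all
  \<open>(F(x) - L(x) - y + k, G(x) + s)\<close> with \<open>x \<in> C\<close>, \<open>k \<in> int K\<close>, \<open>s \<in> S\<close> does not contain the origin.
  The Slater condition provides a point in its algebraic interior of the form \<open>(p, 0)\<close>, and a
  functional \<open>(g, f)\<close> that is nonnegative on the set and positive at that point must have \<open>g \<noteq> 0\<close>.
  After normalizing \<open>g(k) = 1\<close> for some \<open>k \<in> int K\<close>, the operator \<open>T(z) = f(z) k\<close> is a
  multiplier in \<open>L\<^sub>+(S, K)\<close>; this is the lemma \<open>lagrange_multiplier\<close>.
  
  The second and third dual problems need operators \<open>L'\<close> and \<open>L''\<close> as well. They are again of rank one: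
  the inequality \<open>g(y) \<le> g(F(x) - L(x)) + f(G(x))\<close> says that a sum of two convex real functions is
  nonnegative, and when one of them is bounded above near a point where the other is finite, an affine
  function fits between them (\<open>convex_sum_splitting\<close>). Continuity of \<open>F\<close> splits off the
  objective, and continuity of \<open>G\<close> then separates the constraint from the indicator of \<open>C\<close>.
  
  Each of the three dual sets has the form of a union of sets \<open>- WSup (W i)\<close>, where \<open>i\<close> runs through
  the multipliers. The lemma \<open>WInf_eq_WMax_if_tight\<close> isolates what has to be checked: that every
  negated finite primal value lies below some element of each \<open>W i\<close> (weak duality), and that for every
  finite \<open>y\<close> in the weak infimum some \<open>W i\<close> has no element strictly above \<open>- y\<close>. The second condition
  follows from a bound on \<open>g\<close>, and such bounds pass to weak suprema and to sums
  (\<open>WSup_scalarly_le\<close>, \<open>scalarly_le_add\<close>), hence to conjugates and WS-sums. The first one passes to them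
  because a weak supremum dominates every element of its set other than minus infinity (\<open>WSup_dominates\<close>).
  
  The separation theorem is proved for real vector spaces without topology, so that it applies to product
  spaces directly; continuity of the functionals is recovered from bounds on open sets.
\<close>

section \<open>Topology of locally convex spaces\<close>

lemma tendsto_scaleR_locally_convex:
  fixes g :: "'i \<Rightarrow> 'a::locally_convex_space"
  assumes "(f \<longlongrightarrow> a) F" "(g \<longlongrightarrow> b) F"
  shows "((\<lambda>i. f i *\<^sub>R g i) \<longlongrightarrow> a *\<^sub>R b) F"
  using filterlim_compose[OF tendsto_scaleR_Pair filterlim_Pair[OF assms]] by simp

lemma continuous_on_scaleR_locally_convex:
  fixes g :: "'i::topological_space \<Rightarrow> 'a::locally_convex_space"
  assumes "continuous_on A f" "continuous_on A g"
  shows "continuous_on A (\<lambda>i. f i *\<^sub>R g i)"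
  using assms unfolding continuous_on_def by (blast intro: tendsto_scaleR_locally_convex)

lemma open_affine_preimage:
  fixes U :: "'a::locally_convex_space set"
  assumes "open U"
  shows "open {x. a + c *\<^sub>R x \<in> U}"
proof -
  have "continuous_on UNIV (\<lambda>x. a + c *\<^sub>R x)"
    by (intro continuous_on_add continuous_on_scaleR_locally_convex continuous_on_const
        continuous_on_id)
  then show ?thesis
    using assms by (auto simp: continuous_on_open_vimage vimage_def)
qed

lemma open_absorbing:
  fixes U :: "'a::locally_convex_space set"
  assumes "open U" "a \<in> U"
  obtains e where "e > 0" "\<And>t. \<bar>t\<bar> < e \<Longrightarrow> a + t *\<^sub>R b \<in> U"
proof -
  have "continuous_on UNIV (\<lambda>t::real. a + t *\<^sub>R b)"
    by (intro continuous_on_add continuous_on_scaleR_locally_convex continuous_on_const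
        continuous_on_id)
  then have "open ((\<lambda>t::real. a + t *\<^sub>R b) -` U)"
    using assms(1) by (simp add: continuous_on_open_vimage)
  moreover have "0 \<in> (\<lambda>t::real. a + t *\<^sub>R b) -` U"
    using assms(2) by simp
  ultimately obtain e where "e > 0" "\<And>t. dist t 0 < e \<Longrightarrow> t \<in> (\<lambda>t::real. a + t *\<^sub>R b) -` U"
    unfolding open_dist by blast
  then show ?thesis
    by (intro that[of e]) (auto simp: dist_real_def)
qed

text \<open>
  Applying the bound at \<open>a + k (y - x)\<close> and at \<open>a - k (y - x)\<close> gives a two-sided estimate of
  \<open>f(y) - f(x)\<close>, which is as small as desired once \<open>k\<close> is large.
\<close>
lemma linear_continuous_if_bounded_below:
  fixes f :: "'a::locally_convex_space \<Rightarrow> real"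
  assumes "linear f" "open U" "a \<in> U" "\<And>x. x \<in> U \<Longrightarrow> c \<le> f x"
  shows "continuous_on UNIV f"
proof -
  interpret linear f by fact
  define m where "m = \<bar>f a - c\<bar> + 1"
  have m: "m > 0" by (simp add: m_def)
  have "\<exists>W. open W \<and> x \<in> W \<and> f ` W \<subseteq> V" if V: "open V" "f x \<in> V" for x V
  proof -
    obtain e where e: "e > 0" "\<And>s. dist s (f x) < e \<Longrightarrow> s \<in> V"
      using V unfolding open_dist by blast
    define k where "k = m / e"
    have k: "k > 0" using m e by (simp add: k_def)
    define W where "W = {y. (a - k *\<^sub>R x) + k *\<^sub>R y \<in> U} \<inter> {y. (a + k *\<^sub>R x) + (- k) *\<^sub>R y \<in> U}"
    have "dist (f y) (f x) < e" if "y \<in> W" for y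
    proof -
      have "c \<le> f a - k * f x + k * f y" "c \<le> f a + k * f x + (- k) * f y"
        using assms(4)[of "(a - k *\<^sub>R x) + k *\<^sub>R y"] assms(4)[of "(a + k *\<^sub>R x) + (- k) *\<^sub>R y"] that
        by (auto simp: W_def add diff scale neg)
      then have "k * \<bar>f y - f x\<bar> < m"
        by (auto simp: m_def abs_if algebra_simps)
      then have "m * \<bar>f y - f x\<bar> < m * e"
        using e(1) by (simp add: k_def field_simps)
      then show ?thesis using m by (simp add: dist_real_def)
    qed
    moreover have "open W"
      unfolding W_def by (intro open_Int open_affine_preimage assms(2))
    moreover have "x \<in> W"
      using assms(3) by (simp add: W_def)
    ultimately show ?thesis using e(2) by blast
  qed
  then show ?thesis
    unfolding continuous_on_topological by (metis UNIV_I image_subset_iff)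
qed

section \<open>Separation by linear functionals\<close>

definition sublinear :: "('a::real_vector \<Rightarrow> real) \<Rightarrow> bool"
  where "sublinear p \<longleftrightarrow>
    (\<forall>x y. p (x + y) \<le> p x + p y) \<and> (\<forall>c>0. \<forall>x. p (c *\<^sub>R x) \<le> c * p x)"

lemma sublinear_zero:
  assumes "sublinear p" shows "p 0 = 0"
proof -
  have "p (2 *\<^sub>R 0) \<le> 2 * p 0" "p ((1/2) *\<^sub>R 0) \<le> (1/2) * p 0"
    using assms unfolding sublinear_def by (meson zero_less_numeral half_gt_zero_iff zero_less_one)+
  then show ?thesis by simp
qed

lemma sublinear_pos_scale:
  assumes "sublinear p" "c > 0" shows "p (c *\<^sub>R x) = c * p x"
proof -
  have "p (inverse c *\<^sub>R (c *\<^sub>R x)) \<le> inverse c * p (c *\<^sub>R x)" "p (c *\<^sub>R x) \<le> c * p x"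
    using assms unfolding sublinear_def by (meson positive_imp_inverse_positive)+
  then show ?thesis using assms(2) by (simp add: field_simps)
qed

lemma sublinear_minus:
  assumes "sublinear p" shows "0 \<le> p x + p (- x)"
proof -
  have "p (x + - x) \<le> p x + p (- x)"
    using assms unfolding sublinear_def by blast
  then show ?thesis using sublinear_zero[OF assms] by simp
qed

lemma sublinear_odd_imp_linear:
  assumes p: "sublinear p" and odd: "\<And>x. p (- x) = - p x"
  shows "linear p"
proof (rule linearI)
  fix x y
  have "p (x + y) \<le> p x + p y" "p ((x + y) + - y) \<le> p (x + y) + p (- y)"
    using p unfolding sublinear_def by blast+
  then show "p (x + y) = p x + p y" by (simp add: odd)
next
  fix c :: real and x
  show "p (c *\<^sub>R x) = c *\<^sub>R p x"
  proof (cases "c > 0")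
    case True
    then show ?thesis by (simp add: sublinear_pos_scale[OF p])
  next
    case False
    then consider "c = 0" | "- c > 0" by linarith
    then show ?thesis
    proof cases
      case 2
      then have "p ((- c) *\<^sub>R x) = (- c) * p x" by (rule sublinear_pos_scale[OF p])
      then show ?thesis using odd[of "c *\<^sub>R x"] by simp
    qed (simp add: sublinear_zero[OF p])
  qed
qed

text \<open>
  The witness is \<open>r(x) = inf {q(x + t y) - t q(y) | t \<ge> 0}\<close>. It shows that a minimal sublinear functional
  \<open>q\<close> is odd, since \<open>r = q\<close> yields \<open>q(- y) \<le> - q(y)\<close>.
\<close>
lemma sublinear_lowering:
  assumes q: "sublinear q"
  obtains r where "sublinear r" "r \<le> q" "r (- y) \<le> - q y"
proof -
  define R where "R x = (\<lambda>t. q (x + t *\<^sub>R y) - t * q y) ` {0..}" for x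
  define r where "r x = Inf (R x)" for x
  have add: "q (u + v) \<le> q u + q v" for u v
    using q unfolding sublinear_def by blast
  have nonempty: "R x \<noteq> {}" for x by (auto simp: R_def)
  have below: "- q (- x) \<le> s" if s: "s \<in> R x" for x s
  proof -
    obtain t where t: "t \<ge> 0" "s = q (x + t *\<^sub>R y) - t * q y" using s by (auto simp: R_def)
    have "q (t *\<^sub>R y) = t * q y"
      using sublinear_pos_scale[OF q, of t y] sublinear_zero[OF q] t(1) by (cases "t = 0") auto
    moreover have "q (t *\<^sub>R y) \<le> q (x + t *\<^sub>R y) + q (- x)"
      using add[of "x + t *\<^sub>R y" "- x"] by simp
    ultimately show ?thesis using t(2) by linarith
  qed
  then have bdd: "bdd_below (R x)" for x unfolding bdd_below_def by blast
  have le: "r x \<le> q (x + t *\<^sub>R y) - t * q y" if "t \<ge> 0" for x t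
    unfolding r_def by (rule cInf_lower[OF _ bdd]) (use that in \<open>auto simp: R_def\<close>)
  have "sublinear r"
    unfolding sublinear_def
  proof (intro conjI allI impI)
    fix x z
    have *: "r (x + z) - s \<le> s'" if ss: "s \<in> R x" "s' \<in> R z" for s s'
    proof -
      obtain t t' where t: "t \<ge> 0" "s = q (x + t *\<^sub>R y) - t * q y"
          "t' \<ge> 0" "s' = q (z + t' *\<^sub>R y) - t' * q y"
        using ss by (auto simp: R_def)
      have "r (x + z) \<le> q ((x + z) + (t + t') *\<^sub>R y) - (t + t') * q y"
        using t by (intro le) simp
      moreover have "q ((x + z) + (t + t') *\<^sub>R y) \<le> q (x + t *\<^sub>R y) + q (z + t' *\<^sub>R y)"
        using add[of "x + t *\<^sub>R y" "z + t' *\<^sub>R y"] by (simp add: algebra_simps)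
      ultimately show ?thesis using t by (simp add: algebra_simps)
    qed
    then have "r (x + z) - s \<le> r z" if "s \<in> R x" for s
      unfolding r_def[of z] using that by (intro cInf_greatest nonempty) blast
    then have "r (x + z) - r z \<le> s" if "s \<in> R x" for s
      using that by (simp add: algebra_simps)
    then have "r (x + z) - r z \<le> r x"
      unfolding r_def[of x] by (intro cInf_greatest nonempty)
    then show "r (x + z) \<le> r x + r z" by simp
  next
    fix c :: real and x assume c: "c > 0"
    have "r (c *\<^sub>R x) / c \<le> s" if s: "s \<in> R x" for s
    proof -
      obtain t where t: "t \<ge> 0" "s = q (x + t *\<^sub>R y) - t * q y" using s by (auto simp: R_def)
      have "r (c *\<^sub>R x) \<le> q (c *\<^sub>R x + (c * t) *\<^sub>R y) - (c * t) * q y"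
        using c t by (intro le) simp
      also have "q (c *\<^sub>R x + (c * t) *\<^sub>R y) = c * q (x + t *\<^sub>R y)"
        using sublinear_pos_scale[OF q c, of "x + t *\<^sub>R y"] by (simp add: algebra_simps)
      finally have "r (c *\<^sub>R x) \<le> c * s"
        unfolding t(2) right_diff_distrib mult.assoc .
      then show ?thesis using c by (simp add: field_simps)
    qed
    then have "r (c *\<^sub>R x) / c \<le> r x"
      unfolding r_def[of x] by (intro cInf_greatest nonempty)
    then show "r (c *\<^sub>R x) \<le> c * r x" using c by (simp add: field_simps)
  qed
  moreover have "r \<le> q" using le[of 0] by (simp add: le_fun_def)
  moreover have "r (- y) \<le> - q y" using le[of 1 "- y"] sublinear_zero[OF q] by simp
  ultimately show ?thesis by (rule that)
qed

text \<open>
  A form of the Hahn-Banach theorem in which no extension from subspaces occurs: Zorn's lemma yields a minimal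
  sublinear functional below \<open>p\<close>, and a minimal one is odd and hence linear. A chain has its pointwise
  infimum as a lower bound, which is finite because \<open>- p(- x) \<le> q(x)\<close> for all sublinear \<open>q \<le> p\<close>.
\<close>
lemma ex_linear_below_sublinear:
  assumes p: "sublinear p"
  obtains f where "linear f" "f \<le> p"
proof -
  define A where "A = {q. sublinear q \<and> q \<le> p}"
  define P where "P = (\<lambda>f g :: 'a \<Rightarrow> real. g \<le> f)"
  \<comment> \<open>The order is reversed, so that maximal elements for \<open>P\<close> are minimal functionals.\<close>
  have "\<exists>m\<in>A. \<forall>a\<in>A. P m a \<longrightarrow> a = m"
  proof (rule predicate_Zorn)
    show "partial_order_on A (relation_of P A)"
      by (rule partial_order_on_relation_ofI) (auto simp: P_def)
  next
    fix Q assume Q: "Q \<in> Chains (relation_of P A)"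
    have QA: "Q \<subseteq> A" and total: "\<And>q q'. q \<in> Q \<Longrightarrow> q' \<in> Q \<Longrightarrow> q \<le> q' \<or> q' \<le> q"
      using Q unfolding Chains_def relation_of_def P_def by auto
    show "\<exists>u\<in>A. \<forall>a\<in>Q. P a u"
    proof (cases "Q = {}")
      case True
      then show ?thesis using p by (auto simp: A_def)
    next
      case False
      define u where "u x = (INF q\<in>Q. q x)" for x
      have bdd: "bdd_below ((\<lambda>q. q x) ` Q)" for x
      proof (rule bdd_belowI)
        fix s assume "s \<in> (\<lambda>q. q x) ` Q"
        then obtain q where q: "q \<in> Q" "s = q x" by blast
        then have "sublinear q" "q (- x) \<le> p (- x)" using QA by (auto simp: A_def le_fun_def)
        then show "- p (- x) \<le> s" using sublinear_minus[of q x] q by linarith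
      qed
      have le: "u x \<le> q x" if "q \<in> Q" for q x
        unfolding u_def by (rule cINF_lower[OF bdd that])
      have "sublinear u"
        unfolding sublinear_def
      proof (intro conjI allI impI)
        fix x y
        have "u (x + y) \<le> q x + q' y" if qq: "q \<in> Q" "q' \<in> Q" for q q'
        proof -
          obtain r where r: "r \<in> Q" "r \<le> q" "r \<le> q'" using total[OF qq] qq by blast
          have "u (x + y) \<le> r (x + y)" by (rule le[OF r(1)])
          also have "\<dots> \<le> r x + r y" using r(1) QA by (auto simp: A_def sublinear_def)
          also have "\<dots> \<le> q x + q' y" using r(2,3) by (intro add_mono) (auto simp: le_fun_def)
          finally show ?thesis .
        qed
        then have "u (x + y) - q x \<le> q' y" if "q \<in> Q" "q' \<in> Q" for q q'
          using that by (simp add: diff_le_eq add.commute[of "q' y"])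
        then have "u (x + y) - q x \<le> u y" if "q \<in> Q" for q
          unfolding u_def[of y] using that by (intro cINF_greatest[OF False]) blast
        then have "u (x + y) - u y \<le> q x" if "q \<in> Q" for q
          using that by (simp add: diff_le_eq add.commute)
        then have "u (x + y) - u y \<le> u x"
          unfolding u_def[of x] by (intro cINF_greatest[OF False])
        then show "u (x + y) \<le> u x + u y" by simp
      next
        fix c :: real and x assume c: "c > 0"
        have "u (c *\<^sub>R x) / c \<le> q x" if "q \<in> Q" for q
        proof -
          have "u (c *\<^sub>R x) \<le> c * q x"
            using le[OF that, of "c *\<^sub>R x"] sublinear_pos_scale[OF _ c, of q x] QA that
            by (auto simp: A_def)
          then show ?thesis using c by (simp add: field_simps)
        qed
        then have "u (c *\<^sub>R x) / c \<le> u x"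
          unfolding u_def[of x] by (intro cINF_greatest[OF False])
        then show "u (c *\<^sub>R x) \<le> c * u x" using c by (simp add: field_simps)
      qed
      moreover have "u \<le> p"
        using False le QA unfolding A_def le_fun_def by (metis (mono_tags, lifting) all_not_in_conv
            mem_Collect_eq order_trans subsetD)
      ultimately show ?thesis using le by (auto simp: A_def P_def le_fun_def)
    qed
  qed
  then obtain f where f: "sublinear f" "f \<le> p" and min: "\<And>r. sublinear r \<Longrightarrow> r \<le> f \<Longrightarrow> r = f"
    unfolding A_def P_def by (smt (verit) mem_Collect_eq order_trans)
  have "f (- y) = - f y" for y
  proof -
    obtain r where "sublinear r" "r \<le> f" "r (- y) \<le> - f y" using sublinear_lowering[OF f(1)] .
    then have "f (- y) \<le> - f y" using min by blast
    then show ?thesis using sublinear_minus[OF f(1), of y] by linarith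
  qed
  then show ?thesis
    using sublinear_odd_imp_linear[OF f(1)] f(2) that by blast
qed

text \<open>
  Let \<open>P\<close> be the cone of positive multiples of elements of \<open>Q\<close>. The functional
  \<open>p(v) = inf {t | t q0 - v \<in> P}\<close> is sublinear: it is finite because \<open>q0\<close> is an algebraic interior point
  of \<open>Q\<close> and \<open>0 \<notin> P\<close>. A linear functional below \<open>p\<close> is nonnegative on \<open>Q\<close>, as \<open>p(- q) \<le> 0\<close> there,
  and positive at \<open>q0\<close>, as \<open>p(- q0) < 0\<close>.
\<close>
lemma separating_functional:
  fixes Q :: "'a::real_vector set"
  assumes Q: "convex Q" "0 \<notin> Q"
    and core: "\<And>v. \<exists>e>0. q0 + e *\<^sub>R v \<in> Q"
  obtains f :: "'a \<Rightarrow> real" where "linear f" "\<And>q. q \<in> Q \<Longrightarrow> 0 \<le> f q" "0 < f q0"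
proof -
  define P where "P = {c *\<^sub>R q |c q. c > 0 \<and> q \<in> Q}"
  have PI: "c *\<^sub>R q \<in> P" if "c > 0" "q \<in> Q" for c q
    using that by (auto simp: P_def)
  have P0: "0 \<notin> P" using Q(2) by (auto simp: P_def)
  have Pscale: "c *\<^sub>R x \<in> P" if "c > 0" "x \<in> P" for c x
    using that unfolding P_def by (smt (verit) mem_Collect_eq mult_pos_pos scaleR_scaleR)
  have Padd: "x + y \<in> P" if xy: "x \<in> P" "y \<in> P" for x y
  proof -
    obtain c q d r where cq: "c > 0" "q \<in> Q" "x = c *\<^sub>R q" "d > 0" "r \<in> Q" "y = d *\<^sub>R r"
      using xy by (auto simp: P_def)
    have "(c / (c + d)) *\<^sub>R q + (d / (c + d)) *\<^sub>R r \<in> Q"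
      using cq by (intro convexD[OF Q(1)]) (auto simp: add_divide_distrib[symmetric])
    then have "(c + d) *\<^sub>R ((c / (c + d)) *\<^sub>R q + (d / (c + d)) *\<^sub>R r) \<in> P"
      using cq by (intro PI) auto
    also have "(c + d) *\<^sub>R ((c / (c + d)) *\<^sub>R q + (d / (c + d)) *\<^sub>R r) = x + y"
      using cq by (simp add: scaleR_add_right)
    finally show ?thesis .
  qed
  have q0: "q0 \<in> P" using core[of 0] PI[of 1 q0] by auto
  have absorb: "\<exists>t. t *\<^sub>R q0 - v \<in> P" for v
  proof -
    obtain e where "e > 0" "q0 + e *\<^sub>R (- v) \<in> Q" using core by blast
    then have "(1 / e) *\<^sub>R (q0 + e *\<^sub>R (- v)) \<in> P" by (intro PI) auto
    then show ?thesis using \<open>e > 0\<close> by (auto simp: scaleR_add_right scaleR_diff_right)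
  qed
  have pos: "t > 0" if "t *\<^sub>R q0 \<in> P" for t
  proof (rule ccontr)
    assume "\<not> t > 0"
    then consider "t = 0" | "- t > 0" by linarith
    then show False
    proof cases
      case 2
      then have "t *\<^sub>R q0 + (- t) *\<^sub>R q0 \<in> P" by (intro Padd that Pscale q0)
      then show False using P0 by simp
    qed (use that P0 in simp)
  qed
  define R where "R v = {t. t *\<^sub>R q0 - v \<in> P}" for v
  define p where "p v = Inf (R v)" for v
  have nonempty: "R v \<noteq> {}" for v using absorb by (auto simp: R_def)
  have bdd: "bdd_below (R v)" for v
  proof -
    obtain s where s: "s *\<^sub>R q0 - (- v) \<in> P" using absorb by blast
    have "- s \<le> t" if "t \<in> R v" for t
    proof -
      have "(t *\<^sub>R q0 - v) + (s *\<^sub>R q0 - (- v)) \<in> P"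
        using that s by (intro Padd) (auto simp: R_def)
      then have "(t + s) *\<^sub>R q0 \<in> P" by (simp add: algebra_simps)
      from pos[OF this] show ?thesis by linarith
    qed
    then show ?thesis unfolding bdd_below_def by blast
  qed
  have le: "p v \<le> t" if "t *\<^sub>R q0 - v \<in> P" for v t
    unfolding p_def by (rule cInf_lower[OF _ bdd]) (use that in \<open>simp add: R_def\<close>)
  have "sublinear p"
    unfolding sublinear_def
  proof (intro conjI allI impI)
    fix x y
    have "p (x + y) - s \<le> t" if "s \<in> R x" "t \<in> R y" for s t
    proof -
      have "(s *\<^sub>R q0 - x) + (t *\<^sub>R q0 - y) \<in> P" using that by (intro Padd) (auto simp: R_def)
      then have "p (x + y) \<le> s + t" by (intro le) (simp add: algebra_simps)
      then show ?thesis by simp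
    qed
    then have "p (x + y) - s \<le> p y" if "s \<in> R x" for s
      unfolding p_def[of y] using that by (intro cInf_greatest nonempty) blast
    then have "p (x + y) - p y \<le> s" if "s \<in> R x" for s
      using that by (simp add: algebra_simps)
    then have "p (x + y) - p y \<le> p x"
      unfolding p_def[of x] by (intro cInf_greatest nonempty)
    then show "p (x + y) \<le> p x + p y" by simp
  next
    fix c :: real and x assume c: "c > 0"
    have "p (c *\<^sub>R x) / c \<le> s" if "s \<in> R x" for s
    proof -
      have "c *\<^sub>R (s *\<^sub>R q0 - x) \<in> P" using that c by (intro Pscale) (auto simp: R_def)
      then have "p (c *\<^sub>R x) \<le> c * s" by (intro le) (simp add: algebra_simps)
      then show ?thesis using c by (simp add: field_simps)
    qed
    then have "p (c *\<^sub>R x) / c \<le> p x"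
      unfolding p_def[of x] by (intro cInf_greatest nonempty)
    then show "p (c *\<^sub>R x) \<le> c * p x" using c by (simp add: field_simps)
  qed
  then obtain f where f: "linear f" "f \<le> p" using ex_linear_below_sublinear by blast
  have "0 \<le> f q" if "q \<in> Q" for q
  proof -
    have "f (- q) \<le> p (- q)" using f(2) by (simp add: le_fun_def)
    also have "\<dots> \<le> 0" using PI[of 1 q] that by (intro le) simp
    finally show ?thesis by (simp add: linear_neg[OF f(1)])
  qed
  moreover have "0 < f q0"
  proof -
    have "(1 / 2) *\<^sub>R q0 \<in> P" by (intro Pscale q0) simp
    also have "(1 / 2) *\<^sub>R q0 = (- 1 / 2) *\<^sub>R q0 - (- q0)"
      using scaleR_left_distrib[of "- 1 / 2" 1 q0] by simp
    finally have "p (- q0) \<le> - 1 / 2" by (rule le)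
    moreover have "f (- q0) \<le> p (- q0)" using f(2) by (simp add: le_fun_def)
    ultimately show ?thesis by (simp add: linear_neg[OF f(1)])
  qed
  ultimately show ?thesis by (rule that[OF f(1)])
qed

text \<open>
  Fenchel's duality theorem as a sandwich statement. The set of all
  \<open>(x - e, \<phi>(x) + \<psi>(e) + t)\<close> with \<open>t > 0\<close> is convex and misses the origin. The upper bound on \<open>\<phi>\<close> near
  \<open>a\<close> puts a point \<open>(0, s)\<close> in its algebraic interior, so the separating functional is not vertical, and
  dividing by its last coordinate gives the linear part of the affine function.
\<close>
lemma convex_sum_splitting:
  fixes \<phi> \<psi> :: "'a::locally_convex_space \<Rightarrow> real"
  assumes \<phi>: "convex_on D \<phi>" and \<psi>: "convex_on E \<psi>"
    and nonneg: "\<And>x. x \<in> D \<inter> E \<Longrightarrow> 0 \<le> \<phi> x + \<psi> x"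
    and U: "open U" "a \<in> U" "U \<subseteq> D" "\<And>x. x \<in> U \<Longrightarrow> \<phi> x \<le> m" and a: "a \<in> E"
  obtains f :: "'a \<Rightarrow> real" and c where "linear f" "continuous_on UNIV f"
    "\<And>x. x \<in> D \<Longrightarrow> f x + c \<le> \<phi> x" "\<And>x. x \<in> E \<Longrightarrow> - f x - c \<le> \<psi> x"
proof -
  define Q where "Q = {(x - e, \<phi> x + \<psi> e + t) |x e t. x \<in> D \<and> e \<in> E \<and> t > 0}"
  \<comment> \<open>The summand 2 leaves room for \<open>t > 0\<close> after a perturbation of the last coordinate by at most 1.\<close>
  define q0 where "q0 = (0::'a, \<bar>m + \<psi> a\<bar> + 2)"
  have DE: "convex D" "convex E" using \<phi> \<psi> by (auto simp: convex_on_def)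
  have "convex Q"
    unfolding convex_def
  proof (intro ballI allI impI)
    fix q q' :: "'a \<times> real" and u v :: real
    assume q: "q \<in> Q" "q' \<in> Q" and uv: "u \<ge> 0" "v \<ge> 0" "u + v = 1"
    obtain x e t where 1: "x \<in> D" "e \<in> E" "t > 0" "q = (x - e, \<phi> x + \<psi> e + t)"
      using q(1) by (auto simp: Q_def)
    obtain x' e' t' where 2: "x' \<in> D" "e' \<in> E" "t' > 0" "q' = (x' - e', \<phi> x' + \<psi> e' + t')"
      using q(2) by (auto simp: Q_def)
    define y where "y = u *\<^sub>R x + v *\<^sub>R x'"
    define d where "d = u *\<^sub>R e + v *\<^sub>R e'"
    define s where "s = u * (\<phi> x + \<psi> e + t) + v * (\<phi> x' + \<psi> e' + t') - \<phi> y - \<psi> d"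
    have "\<phi> y \<le> u * \<phi> x + v * \<phi> x'" "\<psi> d \<le> u * \<psi> e + v * \<psi> e'"
      using \<phi> \<psi> 1 2 uv by (auto simp: convex_on_def y_def d_def)
    moreover have "0 < u * t + v * t'"
    proof (cases "u = 0")
      case True then show ?thesis using uv 2 by simp
    next
      case False
      then have "0 < u * t" "0 \<le> v * t'" using uv 1 2 by auto
      then show ?thesis by linarith
    qed
    ultimately have "s > 0" unfolding s_def by (simp add: distrib_left)
    moreover have "y \<in> D" "d \<in> E" using DE 1 2 uv by (auto simp: y_def d_def intro: convexD)
    moreover have "u *\<^sub>R q + v *\<^sub>R q' = (y - d, \<phi> y + \<psi> d + s)"
      by (simp add: 1 2 y_def d_def s_def algebra_simps)
    ultimately show "u *\<^sub>R q + v *\<^sub>R q' \<in> Q" unfolding Q_def by blast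
  qed
  moreover have "0 \<notin> Q"
  proof
    assume "0 \<in> Q"
    then obtain x e t where "x \<in> D" "e \<in> E" "t > 0" "x - e = 0" "\<phi> x + \<psi> e + t = 0"
      by (auto simp: Q_def zero_prod_def)
    then show False using nonneg[of x] by auto
  qed
  moreover have "\<exists>e>0. q0 + e *\<^sub>R v \<in> Q" for v
  proof -
    obtain z s where v: "v = (z, s)" by (cases v)
    obtain d where d: "d > 0" "\<And>t. \<bar>t\<bar> < d \<Longrightarrow> a + t *\<^sub>R z \<in> U"
      using open_absorbing[OF U(1,2)] by blast
    define e where "e = min (d / 2) (1 / (\<bar>s\<bar> + 1))"
    have e: "e > 0" "\<bar>e\<bar> < d" using d(1) by (auto simp: e_def min_def)
    have "\<bar>e * s\<bar> \<le> 1"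
    proof -
      have "\<bar>e * s\<bar> \<le> (1 / (\<bar>s\<bar> + 1)) * \<bar>s\<bar>"
        using e(1) unfolding abs_mult by (intro mult_right_mono) (auto simp: e_def)
      also have "\<dots> \<le> 1" by (simp add: field_simps)
      finally show ?thesis .
    qed
    define x where "x = a + e *\<^sub>R z"
    have x: "x \<in> U" using d e by (simp add: x_def)
    define t where "t = \<bar>m + \<psi> a\<bar> + 2 + e * s - \<phi> x - \<psi> a"
    have "t > 0" using U(4)[OF x] \<open>\<bar>e * s\<bar> \<le> 1\<close> unfolding t_def by linarith
    moreover have "q0 + e *\<^sub>R v = (x - a, \<phi> x + \<psi> a + t)"
      by (simp add: q0_def v x_def t_def)
    ultimately show ?thesis using e(1) x U(3) a unfolding Q_def by blast
  qed
  ultimately obtain h :: "'a \<times> real \<Rightarrow> real"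
    where h: "linear h" "\<And>q. q \<in> Q \<Longrightarrow> 0 \<le> h q" "0 < h q0"
    using separating_functional by blast
  define \<beta> where "\<beta> = h (0, 1)"
  define g where "g x = h (x, 0)" for x
  have split: "h (x, t) = g x + t * \<beta>" for x t
  proof -
    have "h ((x, 0) + t *\<^sub>R (0, 1)) = h (x, 0) + t * h (0, 1)"
      by (simp add: linear_add[OF h(1)] linear_scale[OF h(1)] del: scaleR_Pair add_Pair)
    then show ?thesis by (simp add: g_def \<beta>_def)
  qed
  have g: "linear g"
  proof (rule linearI)
    show "g (x + y) = g x + g y" for x y
      using linear_add[OF h(1), of "(x, 0)" "(y, 0)"] by (simp add: g_def)
    show "g (r *\<^sub>R x) = r *\<^sub>R g x" for r x
      using linear_scale[OF h(1), of r "(x, 0)"] by (simp add: g_def)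
  qed
  have "0 < (\<bar>m + \<psi> a\<bar> + 2) * \<beta>"
    using h(3) by (simp add: q0_def split linear_0[OF g])
  then have \<beta>: "\<beta> > 0" unfolding zero_less_mult_iff by linarith
  have key: "0 \<le> g x - g e + (\<phi> x + \<psi> e) * \<beta>" if "x \<in> D" "e \<in> E" for x e
  proof (rule field_le_epsilon)
    fix r :: real assume r: "r > 0"
    have "r / \<beta> > 0" using r \<beta> by simp
    then have "(x - e, \<phi> x + \<psi> e + r / \<beta>) \<in> Q" using that unfolding Q_def by blast
    then have "0 \<le> h (x - e, \<phi> x + \<psi> e + r / \<beta>)" by (rule h(2))
    then show "0 \<le> g x - g e + (\<phi> x + \<psi> e) * \<beta> + r"
      using \<beta> by (simp add: split linear_diff[OF g] distrib_right)
  qed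
  define f where "f x = - g x / \<beta>" for x
  have f: "linear f"
    unfolding f_def using linear_compose_scale_right[OF g, of "- 1 / \<beta>"] by simp
  have key': "f x - \<phi> x \<le> f e + \<psi> e" if "x \<in> D" "e \<in> E" for x e
  proof -
    have "\<beta> * (f x - \<phi> x) \<le> \<beta> * (f e + \<psi> e)"
      using key[OF that] \<beta> by (simp add: f_def algebra_simps)
    then show ?thesis using \<beta> by (simp only: mult_le_cancel_left_pos)
  qed
  define c where "c = (INF x\<in>D. \<phi> x - f x)"
  have D: "D \<noteq> {}" using U by blast
  have "f x + c \<le> \<phi> x" if "x \<in> D" for x
  proof -
    have "bdd_below ((\<lambda>x. \<phi> x - f x) ` D)"
      using key'[OF _ a] by (intro bdd_belowI[of _ "- f a - \<psi> a"]) (force simp: algebra_simps)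
    then have "c \<le> \<phi> x - f x" unfolding c_def by (rule cINF_lower) fact
    then show ?thesis by simp
  qed
  moreover have "- f e - c \<le> \<psi> e" if "e \<in> E" for e
  proof -
    have "- f e - \<psi> e \<le> c"
      unfolding c_def using key'[OF _ that] by (intro cINF_greatest D) (simp add: algebra_simps)
    then show ?thesis by simp
  qed
  moreover have "continuous_on UNIV f"
  proof -
    have "f x \<le> m + f a + \<psi> a" if "x \<in> U" for x
      using key'[OF _ a, of x] U(3,4) that by force
    then have "- m - f a - \<psi> a \<le> - f x" if "x \<in> U" for x
      using that by force
    then have "continuous_on UNIV (\<lambda>x. - f x)"
      using linear_compose_neg[OF f] U(1,2)
      by (intro linear_continuous_if_bounded_below[where U = U and a = a])
    then show ?thesis using continuous_on_minus by fastforce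
  qed
  ultimately show ?thesis using f that by blast
qed

section \<open>Weak suprema and infima\<close>

text \<open>
  The preorder on the extended space that goes with \<^const>\<open>cone_less\<close>. Its finite part uses all of \<open>K\<close>,
  so that it absorbs the terms \<open>T(s) \<in> K\<close> of weak duality.
\<close>
definition cone_le :: "'b::locally_convex_space set \<Rightarrow> 'b extended \<Rightarrow> 'b extended \<Rightarrow> bool"
  where "cone_le K u v \<longleftrightarrow>
    u = Minf \<or> v = Pinf \<or> (\<exists>a b. u = Fin a \<and> v = Fin b \<and> b - a \<in> K)"

text \<open>
  An upper bound that is tested by one functional. Minus infinity satisfies every such bound and plus
  infinity none, as if \<open>g\<close> were extended to the infinite elements.
\<close>
definition scalarly_le :: "('b \<Rightarrow> real) \<Rightarrow> real \<Rightarrow> 'b extended \<Rightarrow> bool"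
  where "scalarly_le g c w \<longleftrightarrow> w \<noteq> Pinf \<and> (\<forall>b. w = Fin b \<longrightarrow> g b \<le> c)"

lemma cone_less_Fin: "cone_less K (Fin u) (Fin v) \<longleftrightarrow> v - u \<in> interior K"
proof -
  have "u - v = - (v - u)" by simp
  then show ?thesis by (simp only: cone_less.simps inj_image_mem_iff[OF inj_uminus])
qed

lemma cone_less_Minf_iff: "cone_less K Minf w \<longleftrightarrow> w \<noteq> Minf"
  by (cases w) auto

lemma uminus_mem_WInf:
  assumes "v \<in> WSup K (uminus ` M)" shows "- v \<in> WInf K M"
  unfolding uminus_WSup_uminus[symmetric] using assms by (rule imageI)

lemma scalarly_le_add:
  fixes g :: "'b::real_vector \<Rightarrow> real"
  assumes g: "linear g" and "scalarly_le g c u" "scalarly_le g d w"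
  shows "scalarly_le g (c + d) (u + w)"
proof -
  have "u + w \<noteq> Pinf" using assms(2,3) by (cases u; cases w) (auto simp: scalarly_le_def)
  moreover have "g b \<le> c + d" if b: "u + w = Fin b" for b
  proof -
    obtain x y where xy: "u = Fin x" "w = Fin y" "b = x + y"
      using b by (cases u; cases w) auto
    then show ?thesis
      using assms(2,3) by (simp add: scalarly_le_def linear_add[OF g] add_mono)
  qed
  ultimately show ?thesis by (simp add: scalarly_le_def)
qed

locale solid_cone =
  fixes K :: "'b::locally_convex_space set"
  assumes convex_K: "convex K" and cone_K: "cone K" and solid_K: "interior K \<noteq> {}"
begin

lemma scale_mem: "c \<ge> 0 \<Longrightarrow> x \<in> K \<Longrightarrow> c *\<^sub>R x \<in> K"
  using cone_K by (auto simp: cone_def)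

lemma add_mem: 
  assumes "x \<in> K" "y \<in> K" shows "x + y \<in> K"
proof -
  have "(1/2) *\<^sub>R x + (1/2) *\<^sub>R y \<in> K" by (intro convexD[OF convex_K] assms) auto
  then have "2 *\<^sub>R ((1/2) *\<^sub>R x + (1/2) *\<^sub>R y) \<in> K" by (intro scale_mem) auto
  then show ?thesis by (simp add: scaleR_add_right)
qed

lemma zero_mem: "0 \<in> K"
  using scale_mem[of 0] solid_K interior_subset by fastforce

lemma interior_add_mem:
  assumes "x \<in> interior K" "y \<in> K" shows "x + y \<in> interior K"
proof (rule interiorI)
  show "open {z. - y + 1 *\<^sub>R z \<in> interior K}" by (intro open_affine_preimage open_interior)
  show "x + y \<in> {z. - y + 1 *\<^sub>R z \<in> interior K}" using assms by simp
  show "{z. - y + 1 *\<^sub>R z \<in> interior K} \<subseteq> K"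
    using add_mem[OF _ assms(2)] interior_subset[of K] by force
qed

lemma interior_scale_mem:
  assumes "x \<in> interior K" "c > 0" shows "c *\<^sub>R x \<in> interior K"
proof (rule interiorI)
  show "open {z. 0 + (1 / c) *\<^sub>R z \<in> interior K}" by (intro open_affine_preimage open_interior)
  show "c *\<^sub>R x \<in> {z. 0 + (1 / c) *\<^sub>R z \<in> interior K}" using assms by simp
  show "{z. 0 + (1 / c) *\<^sub>R z \<in> interior K} \<subseteq> K"
  proof
    fix z assume "z \<in> {z. 0 + (1 / c) *\<^sub>R z \<in> interior K}"
    then have "(1 / c) *\<^sub>R z \<in> K" using interior_subset by auto
    then show "z \<in> K" using scale_mem[of c "(1 / c) *\<^sub>R z"] assms(2) by simp
  qed
qed

text \<open>
  An interior point of a cone is an order unit.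
\<close>
lemma interior_absorbing:
  assumes "k \<in> interior K"
  obtains t where "t > 0" "t *\<^sub>R k + v \<in> interior K"
proof -
  obtain e where e: "e > 0" "\<And>t. \<bar>t\<bar> < e \<Longrightarrow> k + t *\<^sub>R v \<in> interior K"
    using open_absorbing[OF open_interior assms] by blast
  then have "k + (e / 2) *\<^sub>R v \<in> interior K" by simp
  then have "(2 / e) *\<^sub>R (k + (e / 2) *\<^sub>R v) \<in> interior K"
    using e(1) by (intro interior_scale_mem) auto
  then show ?thesis using e(1) by (intro that[of "2 / e"]) (auto simp: scaleR_add_right)
qed

lemma positive_on_interior:
  fixes g :: "'b \<Rightarrow> real"
  assumes "linear g" "\<And>k. k \<in> K \<Longrightarrow> 0 \<le> g k" "k0 \<in> K" "0 < g k0" "k \<in> interior K"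
  shows "0 < g k"
proof -
  obtain t where t: "t > 0" "t *\<^sub>R k + (- k0) \<in> interior K"
    using interior_absorbing[OF assms(5), of "- k0"] by blast
  then have "0 \<le> t * g k - g k0"
    using assms(2)[of "t *\<^sub>R k + (- k0)"] interior_subset[of K]
    by (auto simp: linear_diff[OF assms(1)] linear_scale[OF assms(1)])
  then have "0 < t * g k" using assms(4) by linarith
  then show ?thesis using t(1) by (simp add: zero_less_mult_iff)
qed

lemma cone_less_le_trans:
  assumes uv: "cone_less K u v" and vw: "cone_le K v w"
  shows "cone_less K u w"
proof -
  consider "v = Minf" | "w = Pinf" | a b where "v = Fin a" "w = Fin b" "b - a \<in> K"
    using vw by (auto simp: cone_le_def)
  then show ?thesis
  proof cases
    case 1 then show ?thesis using uv by (cases u) auto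
  next
    case 2 then show ?thesis using uv by (cases u; cases v) auto
  next
    case 3
    show ?thesis
    proof (cases u)
      case (Fin c)
      then have "a - c \<in> interior K" using uv 3 by (simp only: cone_less_Fin)
      then have "(a - c) + (b - a) \<in> interior K" using 3(3) by (rule interior_add_mem)
      also have "(a - c) + (b - a) = b - c" by simp
      finally show ?thesis unfolding Fin 3(2) cone_less_Fin .
    next
      case Pinf
      then show ?thesis using uv by simp
    next
      case Minf
      then show ?thesis using 3(2) by simp
    qed
  qed
qed

lemma cone_le_less_trans:
  assumes "cone_le K u v" "cone_less K v w" shows "cone_less K u w"
proof -
  have "cone_le K (- v) (- u)"
  proof (cases "u = Minf \<or> v = Pinf")
    case False
    then obtain a b where "u = Fin a" "v = Fin b" "b - a \<in> K"
      using assms(1) by (auto simp: cone_le_def)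
    then show ?thesis by (simp add: cone_le_def)
  qed (auto simp: cone_le_def)
  moreover have "cone_less K (- w) (- v)" using assms(2) by (simp add: cone_less_uminus)
  ultimately have "cone_less K (- w) (- u)" by (rule cone_less_le_trans[rotated])
  then show ?thesis by (simp add: cone_less_uminus)
qed

lemma cone_le_trans:
  assumes "cone_le K u v" "cone_le K v w" shows "cone_le K u w"
proof (cases "u = Minf \<or> w = Pinf")
  case False
  then obtain a b c where "u = Fin a" "v = Fin b" "w = Fin c" "b - a \<in> K" "c - b \<in> K"
    using assms by (auto simp: cone_le_def)
  then show ?thesis using add_mem[of "b - a" "c - b"] by (simp add: cone_le_def)
qed (auto simp: cone_le_def)

lemma cone_le_add:
  assumes "cone_le K u v" "cone_le K u' v'" "u \<noteq> Minf" "u' \<noteq> Minf"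
  shows "cone_le K (u + u') (v + v')"
proof (cases "v = Pinf \<or> v' = Pinf")
  case True
  have "v \<noteq> Minf" "v' \<noteq> Minf" using assms by (auto simp: cone_le_def)
  then have "v + v' = Pinf" using True by (cases v; cases v') auto
  then show ?thesis by (simp add: cone_le_def)
next
  case False
  then obtain a b a' b' where "u = Fin a" "v = Fin b" "b - a \<in> K"
      "u' = Fin a'" "v' = Fin b'" "b' - a' \<in> K"
    using assms by (auto simp: cone_le_def)
  then show ?thesis using add_mem[of "b - a" "b' - a'"]
    by (simp add: cone_le_def algebra_simps)
qed

text \<open>
  The finite points strictly below some element of \<open>M\<close>. Weak suprema are the boundary of this open
  lower set if it is neither empty nor the whole space; if it is the whole space, they consist of plus
  infinity.
\<close>
definition below :: "'b extended set \<Rightarrow> 'b set"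
  where "below M = {y. \<exists>w\<in>M. cone_less K (Fin y) w}"

lemma open_below: "open (below M)"
proof -
  have "open {y. cone_less K (Fin y) w}" for w
  proof (cases w)
    case (Fin v)
    then have "{y. cone_less K (Fin y) w} = {y. v + (- 1) *\<^sub>R y \<in> interior K}"
      by (auto simp only: cone_less_Fin) simp_all
    then show ?thesis by (metis open_affine_preimage open_interior)
  qed auto
  moreover have "below M = (\<Union>w\<in>M. {y. cone_less K (Fin y) w})"
    by (auto simp: below_def)
  ultimately show ?thesis by auto
qed

lemma below_diff_mem:
  assumes "y \<in> below M" "k \<in> K" shows "y - k \<in> below M"
proof -
  have "cone_le K (Fin (y - k)) (Fin y)" using assms(2) by (simp add: cone_le_def)
  then show ?thesis using assms(1) cone_le_less_trans by (fastforce simp: below_def)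
qed

lemma Fin_mem_WSup:
  assumes "v \<notin> below M" "\<And>k. k \<in> interior K \<Longrightarrow> v - k \<in> below M"
  shows "Fin v \<in> WSup K M"
  unfolding WSup_def
proof (intro CollectI conjI ballI allI impI)
  fix w assume "w \<in> M"
  then show "\<not> cone_less K (Fin v) w" using assms(1) by (auto simp: below_def)
next
  fix u assume u: "cone_less K u (Fin v)"
  obtain k where k: "k \<in> interior K" using solid_K by blast
  show "\<exists>w\<in>M. cone_less K u w"
  proof (cases u)
    case (Fin a)
    then have "v - (v - a) \<in> below M" using u by (intro assms(2)) (simp only: cone_less_Fin)
    then show ?thesis using Fin by (simp add: below_def)
  next
    case Minf
    obtain w where "w \<in> M" "cone_less K (Fin (v - k)) w"
      using assms(2)[OF k] by (auto simp: below_def)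
    then show ?thesis unfolding Minf cone_less_Minf_iff by (cases w) auto
  qed (use u in auto)
qed

lemma Pinf_mem_WSup:
  assumes "below M = UNIV" shows "Pinf \<in> WSup K M"
  unfolding WSup_def
proof (intro CollectI conjI ballI allI impI)
  fix u assume u: "cone_less K u Pinf"
  have *: "\<exists>w\<in>M. cone_less K (Fin a) w" for a using assms by (auto simp: below_def)
  show "\<exists>w\<in>M. cone_less K u w"
  proof (cases u)
    case Minf
    obtain w where "w \<in> M" "cone_less K (Fin 0) w" using * by blast
    then show ?thesis unfolding Minf cone_less_Minf_iff by (cases w) auto
  qed (use * u in auto)
qed auto

text \<open>
  A line in an interior direction \<open>k\<close> that contains points inside and outside the open lower set crosses its boundary
  at the supremum of the parameters inside. That boundary point belongs to the weak supremum because
  \<open>below M\<close> is open and closed under subtracting elements of \<open>K\<close>.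
\<close>
lemma ray_boundary:
  assumes k: "k \<in> interior K" and s: "y + s *\<^sub>R k \<in> below M" and t: "y + t *\<^sub>R k \<notin> below M"
  obtains r where "r \<le> t" "Fin (y + r *\<^sub>R k) \<in> WSup K M"
proof -
  define A where "A = {s. y + s *\<^sub>R k \<in> below M}"
  have kK: "k \<in> K" using k interior_subset by blast
  have A_le: "s \<le> t" if "s \<in> A" for s
  proof (rule ccontr)
    assume "\<not> s \<le> t"
    then have "(y + s *\<^sub>R k) - (s - t) *\<^sub>R k \<in> below M"
      using that kK by (intro below_diff_mem scale_mem) (auto simp: A_def)
    then show False using t by (simp add: algebra_simps)
  qed
  then have bdd: "bdd_above A" by (auto simp: bdd_above_def)
  have A: "A \<noteq> {}" using s by (auto simp: A_def)
  define r where "r = Sup A"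
  have "r \<le> t" unfolding r_def by (intro cSup_least A A_le)
  moreover have "y + r *\<^sub>R k \<notin> below M"
  proof
    assume "y + r *\<^sub>R k \<in> below M"
    then obtain e where e: "e > 0" "\<And>t. \<bar>t\<bar> < e \<Longrightarrow> (y + r *\<^sub>R k) + t *\<^sub>R k \<in> below M"
      using open_absorbing[OF open_below] by blast
    then have "r + e / 2 \<in> A" using e(2)[of "e / 2"] by (simp add: A_def algebra_simps)
    then have "r + e / 2 \<le> r" unfolding r_def by (intro cSup_upper bdd)
    then show False using e(1) by simp
  qed
  moreover have "(y + r *\<^sub>R k) - l \<in> below M" if l: "l \<in> interior K" for l
  proof -
    obtain e where e: "e > 0" "\<And>t. \<bar>t\<bar> < e \<Longrightarrow> l + t *\<^sub>R (- k) \<in> interior K"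
      using open_absorbing[OF open_interior l] by blast
    obtain s where s: "s \<in> A" "r - e / 2 < s"
      using less_cSup_iff[OF A bdd, of "r - e / 2"] e(1) by (auto simp: r_def)
    have "s \<le> r" unfolding r_def by (intro cSup_upper s bdd)
    then have "l + (r - s) *\<^sub>R (- k) \<in> K" using e s interior_subset[of K] by force
    then have "(y + s *\<^sub>R k) - (l + (r - s) *\<^sub>R (- k)) \<in> below M"
      using s by (intro below_diff_mem) (auto simp: A_def)
    then show ?thesis by (simp add: algebra_simps)
  qed
  ultimately show ?thesis using that Fin_mem_WSup by blast
qed

text \<open>
  Unless \<open>below M\<close> is everything, the line through a finite \<open>w \<in> M\<close> in an interior direction leaves it, and
  cannot do so before reaching \<open>w\<close>; its boundary point is the required element.
\<close>
lemma WSup_dominates: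
  assumes w: "w \<in> M" "w \<noteq> Minf"
  shows "\<exists>a\<in>WSup K M. cone_le K w a"
proof (cases "below M = UNIV")
  case True
  then show ?thesis using Pinf_mem_WSup by (auto simp: cone_le_def)
next
  case False
  obtain k where k: "k \<in> interior K" using solid_K by blast
  then have kK: "k \<in> K" using interior_subset by blast
  obtain z where z: "z \<notin> below M" using False by blast
  show ?thesis
  proof (cases w)
    case (Fin y)
    have neg: "y + s *\<^sub>R k \<in> below M" if "s < 0" for s
    proof -
      have "(- s) *\<^sub>R k \<in> interior K" using k that by (intro interior_scale_mem) auto
      then have "cone_less K (Fin (y + s *\<^sub>R k)) (Fin y)" by (simp only: cone_less_Fin) simp
      then show ?thesis using w(1) Fin unfolding below_def by blast
    qed
    obtain t where "t *\<^sub>R k + (y - z) \<in> interior K" using interior_absorbing[OF k] by blast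
    then have "t *\<^sub>R k + (y - z) \<in> K" using interior_subset by blast
    then have "y + t *\<^sub>R k \<notin> below M"
      using z below_diff_mem[of "y + t *\<^sub>R k" M "t *\<^sub>R k + (y - z)"] by auto
    then obtain r where r: "Fin (y + r *\<^sub>R k) \<in> WSup K M"
      using ray_boundary[OF k neg[of "- 1"]] by auto
    then have "y + r *\<^sub>R k \<notin> below M" by (auto simp: WSup_def below_def)
    then have "r \<ge> 0" using neg[of r] by linarith
    then have "cone_le K w (Fin (y + r *\<^sub>R k))" using Fin kK by (simp add: cone_le_def scale_mem)
    then show ?thesis using r by blast
  next
    case Pinf
    then show ?thesis using z w by (auto simp: below_def)
  qed (use w in auto)
qed

text \<open>
  The same argument after negation, started from a point outside the lower set. The finite element \<open>m\<close> ensures that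
  the line through \<open>- y\<close> meets the lower set of the negated values.
\<close>
lemma WInf_above_lower_bound:
  assumes m: "Fin m \<in> M" and y: "\<And>w. w \<in> M \<Longrightarrow> \<not> cone_less K w (Fin y)"
  shows "\<exists>n\<in>WInf K M. cone_le K (Fin y) n"
proof -
  obtain k where k: "k \<in> interior K" using solid_K by blast
  then have kK: "k \<in> K" using interior_subset by blast
  have "- y + 0 *\<^sub>R k \<notin> below (uminus ` M)"
    using y cone_less_uminus[of K "Fin y"] by (auto simp: below_def)
  moreover obtain t where t: "t *\<^sub>R k + (- m + y) \<in> interior K"
    using interior_absorbing[OF k] by blast
  have "cone_less K (Fin (- y + (- t) *\<^sub>R k)) (Fin (- m))"
    unfolding cone_less_Fin using t by (simp add: algebra_simps)
  then have "- y + (- t) *\<^sub>R k \<in> below (uminus ` M)"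
    using m unfolding below_def by force
  ultimately obtain r where r: "r \<le> 0" "Fin (- y + r *\<^sub>R k) \<in> WSup K (uminus ` M)"
    using ray_boundary[OF k] by blast
  have "- Fin (- y + r *\<^sub>R k) \<in> WInf K M" by (rule uminus_mem_WInf[OF r(2)])
  moreover have "(- r) *\<^sub>R k \<in> K" using r(1) kK by (intro scale_mem) auto
  then have "cone_le K (Fin y) (- Fin (- y + r *\<^sub>R k))" by (simp add: cone_le_def)
  ultimately show ?thesis by blast
qed

text \<open>
  The common skeleton of all strong duality results below: \<open>M\<close> is the set of primal values and the sets
  \<open>- WSup (W i)\<close> make up the dual one. The assumption \<open>upper\<close> is weak duality. It also
  shows, for \<open>v\<close> in the weak infimum, that everything strictly below \<open>- v\<close> is strictly below some element of
  \<open>W i\<close>, so that \<open>tight\<close> suffices for \<open>- v \<in> WSup (W i)\<close>. For the value minus infinity tightness is automatic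
  because nothing exceeds plus infinity. Conversely, if a maximal dual value were not in the
  weak infimum, some element of the weak infimum would lie strictly above it, and this element is itself a dual value.
\<close>
lemma WInf_eq_WMax_if_tight:
  assumes m: "Fin m \<in> M" and I: "I \<noteq> {}"
    and upper: "\<And>i w. i \<in> I \<Longrightarrow> w \<in> M \<Longrightarrow> w \<noteq> Pinf \<Longrightarrow> \<exists>b\<in>W i. cone_le K (- w) b"
    and tight: "\<And>v. Fin v \<in> WInf K M \<Longrightarrow> \<exists>i\<in>I. \<forall>b\<in>W i. \<not> cone_less K (Fin (- v)) b"
  shows "WInf K M = WMax K (\<Union>i\<in>I. uminus ` WSup K (W i))"
proof -
  define N where "N = (\<Union>i\<in>I. uminus ` WSup K (W i))"
  have weak: "\<not> cone_less K w n" if n: "n \<in> N" and w: "w \<in> M" for n w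
  proof
    assume less: "cone_less K w n"
    obtain i b where b: "i \<in> I" "b \<in> WSup K (W i)" "n = - b" using n by (auto simp: N_def)
    have "w \<noteq> Pinf" using less by auto
    then obtain a where a: "a \<in> W i" "cone_le K (- w) a" using upper b(1) w by blast
    have "cone_less K b (- w)" using less cone_less_uminus[of K "- b" w] b(3) by simp
    then have "cone_less K b a" using a(2) by (rule cone_less_le_trans)
    then show False using b(2) a(1) by (auto simp: WSup_def)
  qed
  have sub: "WInf K M \<subseteq> N"
  proof
    fix v assume v: "v \<in> WInf K M"
    then have "v \<noteq> Pinf" using m by (force simp: WInf_def)
    then have "\<exists>i\<in>I. \<forall>b\<in>W i. \<not> cone_less K (- v) b"
      using v tight I by (cases v) auto
    then obtain i where i: "i \<in> I" "\<forall>b\<in>W i. \<not> cone_less K (- v) b" by blast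
    have "\<exists>b\<in>W i. cone_less K u b" if "cone_less K u (- v)" for u
    proof -
      have "cone_less K v (- u)" using that cone_less_uminus[of K "- v" u] by simp
      then obtain w where w: "w \<in> M" "cone_less K w (- u)" using v by (auto simp: WInf_def)
      then have "w \<noteq> Pinf" by auto
      then obtain b where "b \<in> W i" "cone_le K (- w) b" using upper i(1) w(1) by blast
      moreover have "cone_less K u (- w)" using w(2) cone_less_uminus[of K "- u" w] by simp
      ultimately show ?thesis using cone_less_le_trans by blast
    qed
    then have "- v \<in> WSup K (W i)" using i by (auto simp: WSup_def)
    then show "v \<in> N" using i(1) unfolding N_def by force
  qed
  have "WInf K M = WMax K N"
  proof (intro equalityI subsetI)
    fix v assume v: "v \<in> WInf K M"
    then have "\<not> cone_less K v n" if "n \<in> N" for n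
      using weak[OF that] by (auto simp: WInf_def)
    then show "v \<in> WMax K N" using v sub by (auto simp: WMax_def WSup_def)
  next
    fix v assume v: "v \<in> WMax K N"
    have "\<exists>w\<in>M. cone_less K w u" if u: "cone_less K v u" for u
    proof (rule ccontr)
      assume none: "\<not> ?thesis"
      then obtain y where y: "u = Fin y" using u m by (cases u; cases v) auto
      then obtain n where "n \<in> WInf K M" "cone_le K u n"
        using WInf_above_lower_bound[OF m] none by blast
      then have "n \<in> N" "cone_less K v n" using sub u cone_less_le_trans by blast+
      then show False using v by (auto simp: WMax_def WSup_def)
    qed
    then show "v \<in> WInf K M" using weak v by (auto simp: WInf_def WMax_def)
  qed
  then show ?thesis by (simp add: N_def)
qed

text \<open>
  Bounds pass to weak suprema because every finite point strictly below an element of \<open>WSup M\<close> lies strictly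
  below an element of \<open>M\<close>. Plus infinity is excluded since \<open>g\<close> is unbounded along \<open>k0\<close>.
\<close>
lemma WSup_scalarly_le:
  assumes g: "linear g" "\<And>k. k \<in> K \<Longrightarrow> 0 \<le> g k" "k0 \<in> interior K" "0 < g k0"
    and M: "\<And>w. w \<in> M \<Longrightarrow> scalarly_le g c w" and a: "a \<in> WSup K M"
  shows "scalarly_le g c a"
proof -
  have key: "g y \<le> c" if y: "cone_less K (Fin y) a" for y
  proof -
    obtain w where w: "w \<in> M" "cone_less K (Fin y) w" using a y by (auto simp: WSup_def)
    then obtain b where b: "w = Fin b" using M by (cases w) (auto simp: scalarly_le_def)
    then have "b - y \<in> interior K" using w(2) by (simp only: cone_less_Fin)
    then have "0 \<le> g (b - y)" using g(2) interior_subset by blast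
    then show ?thesis using M[OF w(1)] b by (simp add: linear_diff[OF g(1)] scalarly_le_def)
  qed
  have "a \<noteq> Pinf"
  proof
    assume "a = Pinf"
    then have "g (((c + 1) / g k0) *\<^sub>R k0) \<le> c" by (intro key) simp
    then show False using g(4) by (simp add: linear_scale[OF g(1)])
  qed
  moreover have "g b \<le> c" if "a = Fin b" for b
  proof (rule field_le_epsilon)
    fix e :: real assume "e > 0"
    then have "(e / g k0) *\<^sub>R k0 \<in> interior K" using g by (intro interior_scale_mem) auto
    then have "g (b - (e / g k0) *\<^sub>R k0) \<le> c"
      using that by (intro key) (simp only: cone_less_Fin, simp)
    then show "g b \<le> c + e" using g(4) by (simp add: linear_diff[OF g(1)] linear_scale[OF g(1)])
  qed
  ultimately show ?thesis by (simp add: scalarly_le_def)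
qed

lemma conjugate_scalarly_le:
  assumes g: "linear g" "\<And>k. k \<in> K \<Longrightarrow> 0 \<le> g k" "k0 \<in> interior K" "0 < g k0"
    and H: "\<And>x. H x \<noteq> Minf" "\<And>x h. H x = Fin h \<Longrightarrow> g (L x) - g h \<le> c"
    and a: "a \<in> conjugate K H L"
  shows "scalarly_le g c a"
proof (rule WSup_scalarly_le[OF g _ a[unfolded conjugate_def]])
  fix w assume "w \<in> {Fin (L x) - H x |x. True}"
  then obtain x where "w = Fin (L x) - H x" by blast
  then show "scalarly_le g c w"
    using H[of x] by (cases "H x") (auto simp: scalarly_le_def linear_diff[OF g(1)])
qed

text \<open>
  The Young-Fenchel inequality for set-valued conjugates: in a partial order only some elements of the
  conjugate, not all of them, can be expected to lie above \<open>L(x) - H(x)\<close>.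
\<close>
lemma conjugate_dominates:
  assumes "H x = Fin h"
  shows "\<exists>a\<in>conjugate K H L. cone_le K (Fin (L x - h)) a"
  unfolding conjugate_def
proof (rule WSup_dominates)
  have "Fin (L x - h) = Fin (L x) - H x" using assms by simp
  then show "Fin (L x - h) \<in> {Fin (L x) - H x |x. True}" by blast
qed simp

end

section \<open>Scalarization\<close>

definition fin_part :: "'a extended \<Rightarrow> 'a"
  where "fin_part w = (case w of Fin v \<Rightarrow> v | _ \<Rightarrow> undefined)"

definition fin_dom :: "('a \<Rightarrow> 'b extended) \<Rightarrow> 'a set"
  where "fin_dom H = {x. \<exists>h. H x = Fin h}"

lemma fin_part_Fin [simp]: "fin_part (Fin v) = v"
  by (simp add: fin_part_def)

text \<open>
  Convexity of the epigraph in pointwise form, obtained from the points \<open>(x, H(x))\<close> of the epigraph, where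
  \<open>0 \<in> K\<close> enters.
\<close>
lemma cone_convexD:
  assumes cc: "cone_convex K H" and "0 \<in> K" and H: "H x = Fin h" "H x' = Fin h'"
    and uv: "u \<ge> 0" "v \<ge> 0" "u + v = 1"
  obtains h'' where "H (u *\<^sub>R x + v *\<^sub>R x') = Fin h''" "u *\<^sub>R h + v *\<^sub>R h' - h'' \<in> K"
proof -
  define E where "E = {(x, y). \<exists>h. H x = Fin h \<and> h - y \<in> uminus ` K}"
  have "(x, h) \<in> E" "(x', h') \<in> E"
    using H \<open>0 \<in> K\<close> by (auto simp: E_def image_iff)
  moreover have "convex E" using cc by (simp add: cone_convex_def E_def)
  ultimately have "u *\<^sub>R (x, h) + v *\<^sub>R (x', h') \<in> E" using uv by (intro convexD)
  then obtain h'' k where h'': "H (u *\<^sub>R x + v *\<^sub>R x') = Fin h''" "k \<in> K"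
      "h'' - (u *\<^sub>R h + v *\<^sub>R h') = - k"
    by (auto simp: E_def)
  have "u *\<^sub>R h + v *\<^sub>R h' - h'' = - (h'' - (u *\<^sub>R h + v *\<^sub>R h'))" by simp
  also have "\<dots> = k" unfolding h''(3) by simp
  finally show ?thesis using h''(1,2) that by simp
qed

lemma convex_fin_dom:
  assumes "cone_convex K H" "0 \<in> K" shows "convex (fin_dom H)"
  unfolding convex_def
proof (intro ballI allI impI)
  fix x x' and u v :: real
  assume "x \<in> fin_dom H" "x' \<in> fin_dom H" and uv: "0 \<le> u" "0 \<le> v" "u + v = 1"
  then obtain h h' where h: "H x = Fin h" "H x' = Fin h'" by (auto simp: fin_dom_def)
  show "u *\<^sub>R x + v *\<^sub>R x' \<in> fin_dom H"
    by (rule cone_convexD[OF assms h uv]) (simp add: fin_dom_def)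
qed

lemma convex_on_affine:
  fixes l :: "'a::real_vector \<Rightarrow> real"
  assumes "convex A" "linear l" shows "convex_on A (\<lambda>x. l x + c)"
  unfolding convex_on_def
proof (intro conjI ballI allI impI assms(1))
  fix x y :: 'a and u v :: real assume "u + v = 1"
  then have "c = u * c + v * c" by (simp add: distrib_right[symmetric])
  then show "l (u *\<^sub>R x + v *\<^sub>R y) + c \<le> u * (l x + c) + v * (l y + c)"
    by (simp add: linear_add[OF assms(2)] linear_scale[OF assms(2)] algebra_simps)
qed

lemma convex_on_scalarization:
  fixes g :: "'b::locally_convex_space \<Rightarrow> real"
  assumes cc: "cone_convex K H" and K0: "0 \<in> K"
    and g: "linear g" "\<And>k. k \<in> K \<Longrightarrow> 0 \<le> g k"
  shows "convex_on (fin_dom H) (\<lambda>x. g (fin_part (H x)))"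
  unfolding convex_on_def
proof (intro conjI ballI allI impI)
  show "convex (fin_dom H)" by (rule convex_fin_dom[OF cc K0])
next
  fix x x' and u v :: real
  assume "x \<in> fin_dom H" "x' \<in> fin_dom H" and uv: "0 \<le> u" "0 \<le> v" "u + v = 1"
  then obtain h h' where h: "H x = Fin h" "H x' = Fin h'" by (auto simp: fin_dom_def)
  obtain h'' where h'': "H (u *\<^sub>R x + v *\<^sub>R x') = Fin h''" "u *\<^sub>R h + v *\<^sub>R h' - h'' \<in> K"
    using cone_convexD[OF cc K0 h uv] by blast
  have "0 \<le> g (u *\<^sub>R h + v *\<^sub>R h' - h'')" by (rule g(2)[OF h''(2)])
  then show "g (fin_part (H (u *\<^sub>R x + v *\<^sub>R x'))) \<le> u * g (fin_part (H x)) + v * g (fin_part (H x'))"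
    by (simp add: h h'' linear_add[OF g(1)] linear_diff[OF g(1)] linear_scale[OF g(1)])
qed

lemma continuous_at_point_bounded_above:
  fixes g :: "'b::locally_convex_space \<Rightarrow> real"
  assumes "continuous_at_point H x" "continuous_on UNIV g"
  obtains U m where "open U" "x \<in> U" "U \<subseteq> fin_dom H" "\<And>y. y \<in> U \<Longrightarrow> g (fin_part (H y)) \<le> m"
proof -
  obtain h where h: "H x = Fin h"
      "\<And>V. open V \<Longrightarrow> h \<in> V \<Longrightarrow> \<exists>U. open U \<and> x \<in> U \<and> H ` U \<subseteq> Fin ` V"
    using assms(1) unfolding continuous_at_point_def by blast
  have "open (g -` {..<g h + 1})" using assms(2) by (simp add: continuous_on_open_vimage)
  then obtain U where U: "open U" "x \<in> U" "H ` U \<subseteq> Fin ` (g -` {..<g h + 1})"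
    using h(2)[of "g -` {..<g h + 1}"] by auto
  have fin: "\<exists>y'. H y = Fin y' \<and> g y' < g h + 1" if "y \<in> U" for y
  proof -
    have "H y \<in> Fin ` (g -` {..<g h + 1})" using U(3) that by (rule subsetD[OF _ imageI])
    then show ?thesis by auto
  qed
  show ?thesis
  proof (rule that[OF U(1,2)])
    show "U \<subseteq> fin_dom H" using fin by (auto simp: fin_dom_def)
    show "g (fin_part (H y)) \<le> g h + 1" if "y \<in> U" for y using fin[OF that] by auto
  qed
qed

lemma rank_one_cont_linear:
  fixes l :: "'a::locally_convex_space \<Rightarrow> real" and k :: "'b::locally_convex_space"
  assumes "linear l" "continuous_on UNIV l"
  shows "(\<lambda>x. l x *\<^sub>R k) \<in> cont_linear"
  unfolding cont_linear_def
proof (intro CollectI conjI)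
  show "linear (\<lambda>x. l x *\<^sub>R k)"
    by (rule linearI) (simp_all add: linear_add[OF assms(1)] linear_scale[OF assms(1)] scaleR_add_left)
  show "continuous_on UNIV (\<lambda>x. l x *\<^sub>R k)"
    by (intro continuous_on_scaleR_locally_convex assms continuous_on_const)
qed

lemma nonneg_slope:
  fixes a b :: real
  assumes "\<And>t. t > 0 \<Longrightarrow> 0 \<le> a + t * b" shows "0 \<le> b"
proof (rule ccontr)
  assume "\<not> 0 \<le> b"
  then have "0 \<le> a + ((\<bar>a\<bar> + 1) / - b) * b" by (intro assms divide_pos_pos) auto
  then show False using \<open>\<not> 0 \<le> b\<close> by simp
qed

lemma nonneg_intercept:
  fixes a b :: real
  assumes "\<And>t. t > 0 \<Longrightarrow> 0 \<le> a + t * b" "b > 0" shows "0 \<le> a"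
proof (rule field_le_epsilon)
  fix e :: real assume "e > 0"
  then show "0 \<le> a + e" using assms(1)[of "e / b"] assms(2) by simp
qed

section \<open>Multipliers for cone-constrained programs\<close>

text \<open>
  A pair of positive continuous functionals \<open>g\<close> and \<open>f\<close> for the objective and the constraint. The point \<open>k\<close> with
  \<open>g(k) = 1\<close> turns real functionals \<open>l\<close> into operators \<open>l(x) k\<close> on which \<open>g\<close> recovers \<open>l\<close>.
\<close>
definition normalized_multiplier ::
    "'b::locally_convex_space set \<Rightarrow> 'c::locally_convex_space set
      \<Rightarrow> ('b \<Rightarrow> real) \<Rightarrow> 'b \<Rightarrow> ('c \<Rightarrow> real) \<Rightarrow> bool"
  where "normalized_multiplier K S g k f \<longleftrightarrow>
    linear g \<and> continuous_on UNIV g \<and> (\<forall>y\<in>K. 0 \<le> g y) \<and> k \<in> interior K \<and> g k = 1 \<and>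
    linear f \<and> continuous_on UNIV f \<and> (\<forall>z\<in>S. 0 \<le> f z)"

lemma normalized_multiplier_pos_cont_linear:
  assumes "normalized_multiplier K S g k f" "cone K"
  shows "(\<lambda>z. f z *\<^sub>R k) \<in> pos_cont_linear S K"
proof -
  have "k \<in> K" using assms(1) interior_subset by (auto simp: normalized_multiplier_def)
  then have "f z *\<^sub>R k \<in> K" if "z \<in> S" for z
    using assms that by (auto simp: normalized_multiplier_def cone_def)
  then show ?thesis
    using assms(1) rank_one_cont_linear
    by (auto simp: pos_cont_linear_def normalized_multiplier_def)
qed

lemma (in solid_cone) normalized_multiplierD:
  assumes "normalized_multiplier K S g k f"
  shows "linear g" "\<And>a. a \<in> K \<Longrightarrow> 0 \<le> g a" "k \<in> interior K" "0 < g k" "g k = 1"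
  using assms by (auto simp: normalized_multiplier_def)

lemma (in solid_cone) normalized_multiplier_not_less:
  assumes gkf: "normalized_multiplier K S g k f" and w: "scalarly_le g (g v) w"
  shows "\<not> cone_less K (Fin v) w"
proof
  note g = normalized_multiplierD[OF gkf]
  assume less: "cone_less K (Fin v) w"
  then obtain b where b: "w = Fin b" using w by (cases w) (auto simp: scalarly_le_def)
  then have diff: "b - v \<in> interior K" using less by (simp only: cone_less_Fin)
  have "k \<in> K" using g(3) interior_subset by blast
  from positive_on_interior[OF g(1,2) this g(4) diff] have "0 < g (b - v)" by simp
  then show False using w b by (simp add: scalarly_le_def linear_diff[OF g(1)])
qed

locale cone_program = solid_cone K
  for K :: "'y::locally_convex_space set" +
  fixes S :: "'z::locally_convex_space set"
    and F :: "'x::locally_convex_space \<Rightarrow> 'y extended" and G :: "'x \<Rightarrow> 'z extended"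
    and C :: "'x set"
  assumes convex_S: "convex S" and cone_S: "cone S" and nonempty_S: "S \<noteq> {}"
    and F_neq_Minf: "F x \<noteq> Minf" and convex_F: "cone_convex K F"
    and G_neq_Minf: "G x \<noteq> Minf" and convex_G: "cone_convex S G"
    and convex_C: "convex C"
    and feasible_dom: "feasible S C G \<inter> effdom F \<noteq> {}"
begin

lemma zero_mem_S: "0 \<in> S"
  using nonempty_S cone_contains_0[OF cone_S] by simp

lemma tilt_Fin: "F x = Fin h \<Longrightarrow> tilt F L x = Fin (h - L x)"
  by (simp add: tilt_def)

lemma tilt_cases:
  obtains "tilt F L x = Pinf" "F x = Pinf" | h where "F x = Fin h" "tilt F L x = Fin (h - L x)"
proof (cases "F x")
  case (Fin h)
  show ?thesis by (rule that(2)[OF Fin tilt_Fin[OF Fin]])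
next
  case Pinf
  show ?thesis by (rule that(1)) (simp_all add: Pinf tilt_def)
next
  case Minf
  then show ?thesis using F_neq_Minf[of x] by simp
qed

lemma G_cases:
  obtains "G x = Pinf" "compose_ext T G x = Pinf"
  | s where "G x = Fin s" "compose_ext T G x = Fin (T s)"
proof (cases "G x")
  case (Fin s)
  show ?thesis by (rule that(2)) (simp_all add: Fin compose_ext_def)
next
  case Pinf
  show ?thesis by (rule that(1)) (simp_all add: Pinf compose_ext_def)
next
  case Minf
  then show ?thesis using G_neq_Minf[of x] by simp
qed

text \<open>
  Separation of the origin from the set \<open>Q\<close> of all \<open>(F(x) - L(x) - y + k, G(x) + s)\<close> with \<open>k \<in> int K\<close> and
  \<open>s \<in> S\<close>. If \<open>0 \<in> Q\<close>, then \<open>x\<close> would be feasible with a value strictly below \<open>y\<close>. A Slater point \<open>x1\<close> contributes the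
  algebraic interior point \<open>(p + k0, 0)\<close>. Since its second coordinate vanishes, positivity of the separating
  functional there means \<open>g(p + k0) > 0\<close>, which rules out \<open>g = 0\<close>.
\<close>
lemma lagrange_multiplier:
  assumes L: "L \<in> cont_linear" and slater: "regularity1 S C F G"
    and y: "Fin y \<in> WInf K {tilt F L x |x. x \<in> feasible S C G}"
  obtains g k f where "normalized_multiplier K S g k f"
    "\<And>x h s. x \<in> C \<Longrightarrow> F x = Fin h \<Longrightarrow> G x = Fin s \<Longrightarrow> g y \<le> g (h - L x) + f s"
proof -
  obtain x1 s1 where x1: "x1 \<in> C" "F x1 \<noteq> Pinf" "G x1 = Fin (- s1)" "s1 \<in> interior S"
    using slater by (auto simp: regularity1_def effdom_def)
  obtain h1 where h1: "F x1 = Fin h1" using x1(2) F_neq_Minf[of x1] by (cases "F x1") auto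
  interpret S: solid_cone S by unfold_locales (use convex_S cone_S x1 in auto)
  have "linear L" using L by (simp add: cont_linear_def)
  obtain k0 where k0: "k0 \<in> interior K" using solid_K by blast
  define Q where "Q = {(h - L x - y + k, s + l) |x h s k l.
    x \<in> C \<and> F x = Fin h \<and> G x = Fin s \<and> k \<in> interior K \<and> l \<in> S}"
  have QI: "(h - L x - y + k, s + l) \<in> Q"
    if "x \<in> C" "F x = Fin h" "G x = Fin s" "k \<in> interior K" "l \<in> S" for x h s k l
    using that unfolding Q_def by blast
  define p where "p = h1 - L x1 - y"
  have Q1: "(p + k, l) \<in> Q" if "k \<in> interior K" "s1 + l \<in> S" for k l
    using QI[OF x1(1) h1 x1(3) that] by (simp add: p_def)
  have "convex Q"
    unfolding convex_def
  proof (intro ballI allI impI)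
    fix q q' and u v :: real assume q: "q \<in> Q" "q' \<in> Q" and uv: "0 \<le> u" "0 \<le> v" "u + v = 1"
    obtain x h s k l where 1: "x \<in> C" "F x = Fin h" "G x = Fin s" "k \<in> interior K" "l \<in> S"
        "q = (h - L x - y + k, s + l)"
      using q(1) by (auto simp: Q_def)
    obtain x' h' s' k' l' where 2: "x' \<in> C" "F x' = Fin h'" "G x' = Fin s'" "k' \<in> interior K"
        "l' \<in> S" "q' = (h' - L x' - y + k', s' + l')"
      using q(2) by (auto simp: Q_def)
    define x'' where "x'' = u *\<^sub>R x + v *\<^sub>R x'"
    obtain h'' where h'': "F x'' = Fin h''" "u *\<^sub>R h + v *\<^sub>R h' - h'' \<in> K"
      unfolding x''_def using cone_convexD[OF convex_F zero_mem 1(2) 2(2) uv] by blast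
    obtain s'' where s'': "G x'' = Fin s''" "u *\<^sub>R s + v *\<^sub>R s' - s'' \<in> S"
      unfolding x''_def using cone_convexD[OF convex_G zero_mem_S 1(3) 2(3) uv] by blast
    have "u *\<^sub>R k + v *\<^sub>R k' \<in> interior K"
    proof (cases "u = 0")
      case False
      have "u *\<^sub>R k \<in> interior K" using False uv 1(4) by (intro interior_scale_mem) auto
      moreover have "v *\<^sub>R k' \<in> K" using uv 2(4) interior_subset by (intro scale_mem) auto
      ultimately show ?thesis by (rule interior_add_mem)
    qed (use uv 2 in simp)
    then have k'': "(u *\<^sub>R k + v *\<^sub>R k') + (u *\<^sub>R h + v *\<^sub>R h' - h'') \<in> interior K"
      using h''(2) by (rule interior_add_mem)
    have "u *\<^sub>R l + v *\<^sub>R l' \<in> S" using 1 2 uv by (intro convexD[OF convex_S])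
    then have l'': "(u *\<^sub>R l + v *\<^sub>R l') + (u *\<^sub>R s + v *\<^sub>R s' - s'') \<in> S"
      using s''(2) by (rule S.add_mem)
    have "x'' \<in> C" unfolding x''_def using 1 2 uv by (intro convexD[OF convex_C])
    from QI[OF this h''(1) s''(1) k'' l'']
    have "(u *\<^sub>R (h - L x + k) + v *\<^sub>R (h' - L x' + k') - y, u *\<^sub>R (s + l) + v *\<^sub>R (s' + l')) \<in> Q"
      by (simp add: x''_def linear_add[OF \<open>linear L\<close>] linear_scale[OF \<open>linear L\<close>] algebra_simps)
    moreover have "y = u *\<^sub>R y + v *\<^sub>R y" using uv(3) by (simp add: scaleR_add_left[symmetric])
    then have "u *\<^sub>R (h - L x + k) + v *\<^sub>R (h' - L x' + k') - y =
        u *\<^sub>R (h - L x - y + k) + v *\<^sub>R (h' - L x' - y + k')"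
      by (simp add: algebra_simps)
    ultimately show "u *\<^sub>R q + v *\<^sub>R q' \<in> Q"
      using 1(6) 2(6) by simp
  qed
  moreover have "0 \<notin> Q"
  proof
    assume "0 \<in> Q"
    then obtain x h s k l where 0: "x \<in> C" "F x = Fin h" "G x = Fin s" "k \<in> interior K" "l \<in> S"
        "0 = h - L x - y + k" "0 = s + l"
      by (auto simp: Q_def zero_prod_def)
    have "s = - l" using 0(7) by (simp add: eq_neg_iff_add_eq_0)
    then have "x \<in> feasible S C G" using 0 by (auto simp: feasible_def)
    moreover have "y - (h - L x) = k" using 0(6) by (simp add: algebra_simps)
    then have "cone_less K (tilt F L x) (Fin y)"
      unfolding tilt_Fin[OF 0(2)] cone_less_Fin using 0(4) by simp
    ultimately show False using y unfolding WInf_def by blast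
  qed
  moreover have "\<exists>e>0. (p + k0, 0) + e *\<^sub>R q \<in> Q" for q
  proof -
    obtain a b where q: "q = (a, b)" by (cases q)
    obtain d where d: "d > 0" "\<And>t. \<bar>t\<bar> < d \<Longrightarrow> k0 + t *\<^sub>R a \<in> interior K"
      using open_absorbing[OF open_interior k0] by blast
    obtain d' where d': "d' > 0" "\<And>t. \<bar>t\<bar> < d' \<Longrightarrow> s1 + t *\<^sub>R b \<in> interior S"
      using open_absorbing[OF open_interior x1(4)] by blast
    define e where "e = min d d' / 2"
    have e: "e > 0" "\<bar>e\<bar> < d" "\<bar>e\<bar> < d'" using d(1) d'(1) by (auto simp: e_def min_def)
    have "(p + (k0 + e *\<^sub>R a), e *\<^sub>R b) \<in> Q"
      using d(2)[OF e(2)] d'(2)[OF e(3)] interior_subset[of S] by (intro Q1) auto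
    then show ?thesis using e(1) by (auto simp: q add.assoc)
  qed
  ultimately obtain \<Lambda> :: "'y \<times> 'z \<Rightarrow> real"
    where \<Lambda>: "linear \<Lambda>" "\<And>q. q \<in> Q \<Longrightarrow> 0 \<le> \<Lambda> q" "0 < \<Lambda> (p + k0, 0)"
    using separating_functional[of Q "(p + k0, 0)"] by blast
  define g where "g a = \<Lambda> (a, 0)" for a
  define f where "f b = \<Lambda> (0, b)" for b
  have split: "\<Lambda> (a, b) = g a + f b" for a b
    using linear_add[OF \<Lambda>(1), of "(a, 0)" "(0, b)"] by (simp add: g_def f_def)
  have g: "linear g"
  proof (rule linearI)
    show "g (a + b) = g a + g b" for a b
      using linear_add[OF \<Lambda>(1), of "(a, 0)" "(b, 0)"] by (simp add: g_def)
    show "g (r *\<^sub>R a) = r *\<^sub>R g a" for r a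
      using linear_scale[OF \<Lambda>(1), of r "(a, 0)"] by (simp add: g_def)
  qed
  have f: "linear f"
  proof (rule linearI)
    show "f (a + b) = f a + f b" for a b
      using linear_add[OF \<Lambda>(1), of "(0, a)" "(0, b)"] by (simp add: f_def)
    show "f (r *\<^sub>R a) = r *\<^sub>R f a" for r a
      using linear_scale[OF \<Lambda>(1), of r "(0, a)"] by (simp add: f_def)
  qed
  have s1: "s1 \<in> S" using x1(4) interior_subset by blast
  \<comment> \<open>Moving away along a direction of the cone stays in \<open>Q\<close>, so the functional has nonnegative slope there.\<close>
  have g_nonneg: "0 \<le> g k" if "k \<in> K" for k
  proof (rule nonneg_slope)
    fix t :: real assume "t > 0"
    then have "k0 + t *\<^sub>R k \<in> interior K" using k0 that by (intro interior_add_mem scale_mem) auto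
    then have "0 \<le> \<Lambda> (p + (k0 + t *\<^sub>R k), 0)" using s1 by (intro \<Lambda>(2) Q1) auto
    then show "0 \<le> g (p + k0) + t * g k"
      by (simp add: split linear_0[OF f] linear_add[OF g] linear_scale[OF g])
  qed
  have f_nonneg: "0 \<le> f l" if "l \<in> S" for l
  proof (rule nonneg_slope)
    fix t :: real assume "t > 0"
    then have "s1 + t *\<^sub>R l \<in> S" using s1 that by (intro S.add_mem S.scale_mem) auto
    then have "0 \<le> \<Lambda> (p + k0, t *\<^sub>R l)" using k0 by (intro \<Lambda>(2) Q1) auto
    then show "0 \<le> g (p + k0) + t * f l"
      by (simp add: split linear_scale[OF f])
  qed
  have g_k0: "0 < g k0"
  proof -
    obtain t where t: "t > 0" "t *\<^sub>R k0 + - (p + k0) \<in> interior K"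
      using interior_absorbing[OF k0, of "- (p + k0)"] by blast
    then have "0 \<le> g (t *\<^sub>R k0 + - (p + k0))" using interior_subset[of K] by (intro g_nonneg) blast
    moreover have "0 < g (p + k0)" using \<Lambda>(3) by (simp add: split linear_0[OF f])
    ultimately have "0 < t * g k0"
      unfolding linear_add[OF g] linear_neg[OF g] linear_scale[OF g] by simp
    then show ?thesis using t(1) by (simp add: zero_less_mult_iff)
  qed
  define k where "k = (1 / g k0) *\<^sub>R k0"
  have "k \<in> interior K" unfolding k_def using g_k0 k0 by (intro interior_scale_mem) auto
  moreover have "g k = 1" using g_k0 by (simp add: k_def linear_scale[OF g])
  moreover have "continuous_on UNIV g"
    by (rule linear_continuous_if_bounded_below[OF g open_interior k0, of 0])
      (use g_nonneg interior_subset[of K] in blast)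
  moreover have "continuous_on UNIV f"
    by (rule linear_continuous_if_bounded_below[OF f open_interior x1(4), of 0])
      (use f_nonneg interior_subset[of S] in blast)
  ultimately have "normalized_multiplier K S g k f"
    using g f g_nonneg f_nonneg by (simp add: normalized_multiplier_def)
  moreover have "g y \<le> g (h - L x) + f s" if "x \<in> C" "F x = Fin h" "G x = Fin s" for x h s
  proof -
    have "0 \<le> (g (h - L x - y) + f s) + t * g k0" if "t > 0" for t
    proof -
      have "(h - L x - y + t *\<^sub>R k0, s + 0) \<in> Q"
        using \<open>x \<in> C\<close> \<open>F x = Fin h\<close> \<open>G x = Fin s\<close> that k0 zero_mem_S
        by (intro QI interior_scale_mem)
      then have "0 \<le> \<Lambda> (h - L x - y + t *\<^sub>R k0, s)" using \<Lambda>(2) by simp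
      then show ?thesis by (simp add: split linear_add[OF g] linear_scale[OF g])
    qed
    then have "0 \<le> g (h - L x - y) + f s" using g_k0 by (rule nonneg_intercept)
    then show ?thesis by (simp add: linear_diff[OF g])
  qed
  ultimately show ?thesis by (rule that)
qed

end

section \<open>Strong duality\<close>

context cone_program
begin

lemma feasible_value_finite:
  obtains m where "Fin m \<in> {tilt F L x |x. x \<in> feasible S C G}"
proof -
  obtain x where x: "x \<in> feasible S C G" "F x \<noteq> Pinf"
    using feasible_dom by (auto simp: effdom_def)
  then obtain h where "F x = Fin h" using F_neq_Minf[of x] by (cases "F x") auto
  from tilt_Fin[OF this, of L] x(1) show ?thesis
    by (intro that[of "h - L x"]) (metis (mono_tags, lifting) mem_Collect_eq)
qed

lemma feasible_valueE:
  assumes "w \<in> {tilt F L x |x. x \<in> feasible S C G}" "w \<noteq> Pinf"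
  obtains x h s where "x \<in> C" "F x = Fin h" "G x = Fin (- s)" "s \<in> S" "w = Fin (h - L x)"
proof -
  obtain x where x: "x \<in> feasible S C G" "w = tilt F L x" using assms(1) by blast
  obtain s where s: "x \<in> C" "G x = Fin (- s)" "s \<in> S" using x(1) by (auto simp: feasible_def)
  show ?thesis
  proof (cases rule: tilt_cases[of L x])
    case (2 h)
    then show ?thesis using that s x(2) by simp
  qed (use assms(2) x(2) in simp)
qed

lemma zero_pos_cont_linear: "(\<lambda>_. 0) \<in> pos_cont_linear S K"
  using zero_mem by (auto simp: pos_cont_linear_def cont_linear_def intro: linearI)

lemma pos_cont_linearD:
  assumes "T \<in> pos_cont_linear S K"
  shows "T (- s) = - T s" "s \<in> S \<Longrightarrow> T s \<in> K"
  using assms by (auto simp: pos_cont_linear_def cont_linear_def linear_neg)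

text \<open>
  For \<open>T = f k\<close> the multiplier inequality bounds \<open>g\<close> by \<open>g(- y)\<close> on all negated Lagrangian values, so none of them is
  strictly above \<open>- y\<close>.
\<close>
lemma stable_strong_duality1:
  assumes slater: "regularity1 S C F G"
  shows "stable_strong_duality K S C F G (dual_set1 K S C F G)"
  unfolding stable_strong_duality_def
proof
  fix L :: "'x \<Rightarrow> 'y" assume L: "L \<in> cont_linear"
  define M where "M = {tilt F L x |x. x \<in> feasible S C G}"
  define W where "W T = uminus ` {tilt F L x + compose_ext T G x |x. x \<in> C}" for T :: "'z \<Rightarrow> 'y"
  have WI: "- (tilt F L x + compose_ext T G x) \<in> W T" if "x \<in> C" for x T
    using that unfolding W_def by blast
  obtain m where m: "Fin m \<in> M" unfolding M_def using feasible_value_finite .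
  have "WInf K M = WMax K (\<Union>T\<in>pos_cont_linear S K. uminus ` WSup K (W T))"
  proof (rule WInf_eq_WMax_if_tight[OF m])
    show "pos_cont_linear S K \<noteq> {}" using zero_pos_cont_linear by blast
  next
    fix T w assume T: "T \<in> pos_cont_linear S K" and w: "w \<in> M" "w \<noteq> Pinf"
    obtain x h s where x: "x \<in> C" "F x = Fin h" "G x = Fin (- s)" "s \<in> S" "w = Fin (h - L x)"
      using feasible_valueE[OF w[unfolded M_def]] .
    have "- (tilt F L x + compose_ext T G x) = Fin (T s - (h - L x))"
      using x pos_cont_linearD(1)[OF T, of s] by (simp add: tilt_Fin compose_ext_def)
    moreover have "cone_le K (- w) (Fin (T s - (h - L x)))"
      using x(4,5) pos_cont_linearD(2)[OF T] by (simp add: cone_le_def)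
    ultimately show "\<exists>b\<in>W T. cone_le K (- w) b" using WI[OF x(1), of T] by metis
  next
    fix y assume y: "Fin y \<in> WInf K M"
    obtain g k f where gkf: "normalized_multiplier K S g k f"
      and bound: "\<And>x h s. x \<in> C \<Longrightarrow> F x = Fin h \<Longrightarrow> G x = Fin s \<Longrightarrow> g y \<le> g (h - L x) + f s"
      using lagrange_multiplier[OF L slater y[unfolded M_def]] by blast
    note g = normalized_multiplierD[OF gkf]
    define T where "T z = f z *\<^sub>R k" for z
    have "scalarly_le g (g (- y)) b" if b: "b \<in> W T" for b
    proof -
      obtain x where x: "x \<in> C" "b = - (tilt F L x + compose_ext T G x)"
        using b by (auto simp: W_def)
      show ?thesis
      proof (cases rule: tilt_cases[of L x])
        case 1
        then show ?thesis using x(2) G_neq_Minf[of x]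
          by (cases "G x") (simp_all add: scalarly_le_def compose_ext_def)
      next
        case (2 h)
        show ?thesis
        proof (cases rule: G_cases[of x T])
          case 1
          then show ?thesis using 2 x(2) by (simp add: scalarly_le_def)
        next
          case (2 s)
          have "g (- (h - L x + T s)) = - (g (h - L x) + f s)"
            unfolding linear_neg[OF g(1)] linear_add[OF g(1)] T_def linear_scale[OF g(1)] g(5) by simp
          then show ?thesis
            using 2 \<open>tilt F L x = Fin (h - L x)\<close> x(2) bound[OF x(1) \<open>F x = Fin h\<close> 2(1)]
            by (simp add: scalarly_le_def linear_neg[OF g(1)])
        qed
      qed
    qed
    then have "\<forall>b\<in>W T. \<not> cone_less K (Fin (- y)) b"
      using normalized_multiplier_not_less[OF gkf] by blast
    moreover have "T \<in> pos_cont_linear S K"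
      unfolding T_def using normalized_multiplier_pos_cont_linear[OF gkf cone_K] .
    ultimately show "\<exists>T\<in>pos_cont_linear S K. \<forall>b\<in>W T. \<not> cone_less K (Fin (- y)) b" by blast
  qed
  also have "(\<Union>T\<in>pos_cont_linear S K. uminus ` WSup K (W T)) = dual_set1 K S C F G L"
    by (simp add: W_def dual_set1_def uminus_WSup_uminus)
  finally show "WInf K {tilt F L x |x. x \<in> feasible S C G} = WMax K (dual_set1 K S C F G L)"
    by (simp add: M_def)
qed

text \<open>
  The bound states \<open>0 \<le> \<phi> + \<psi>\<close> for \<open>\<phi> = g \<circ> F\<close> and \<open>\<psi> = f \<circ> G - g \<circ> L - g(y)\<close> on \<open>C\<close>. The tilt by
  \<open>L\<close> is assigned to \<open>\<psi>\<close>, so that continuity of \<open>F\<close> directly bounds \<open>\<phi>\<close>; this is why the resulting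
  functional is \<open>r - g \<circ> L\<close> instead of the separating \<open>r\<close>.
\<close>
lemma objective_splitting:
  assumes L: "L \<in> cont_linear" and gkf: "normalized_multiplier K S g k f"
    and bound: "\<And>x h s. x \<in> C \<Longrightarrow> F x = Fin h \<Longrightarrow> G x = Fin s \<Longrightarrow> g y \<le> g (h - L x) + f s"
    and reg: "regularity2 C F G"
  obtains l c where "linear l" "continuous_on UNIV l"
    "\<And>x h. F x = Fin h \<Longrightarrow> l x - g (h - L x) \<le> - c"
    "\<And>x s. x \<in> C \<Longrightarrow> G x = Fin s \<Longrightarrow> - l x - f s \<le> c - g y"
proof -
  have g: "linear g" "continuous_on UNIV g" "\<And>k. k \<in> K \<Longrightarrow> 0 \<le> g k"
    and f: "linear f" "\<And>z. z \<in> S \<Longrightarrow> 0 \<le> f z"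
    using gkf by (auto simp: normalized_multiplier_def)
  have lin: "linear L" "continuous_on UNIV L" using L by (auto simp: cont_linear_def)
  have gL: "linear (\<lambda>x. g (L x))" "continuous_on UNIV (\<lambda>x. g (L x))"
    using linear_compose[OF lin(1) g(1)] continuous_on_compose2[OF g(2) lin(2)]
    by (auto simp: o_def)
  define E where "E = C \<inter> fin_dom G"
  define \<psi> where "\<psi> x = f (fin_part (G x)) + (- g (L x) + - g y)" for x
  have "convex E" unfolding E_def
    by (intro convex_Int convex_C convex_fin_dom[OF convex_G zero_mem_S])
  then have "convex_on E \<psi>"
    unfolding \<psi>_def
    by (intro convex_on_add convex_on_affine linear_compose_neg gL
        convex_on_subset[OF convex_on_scalarization[OF convex_G zero_mem_S f]])
      (auto simp: E_def)
  moreover have "convex_on (fin_dom F) (\<lambda>x. g (fin_part (F x)))"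
    by (rule convex_on_scalarization[OF convex_F zero_mem g(1,3)])
  moreover have "0 \<le> g (fin_part (F x)) + \<psi> x" if x: "x \<in> fin_dom F \<inter> E" for x
  proof -
    obtain h s where "x \<in> C" "F x = Fin h" "G x = Fin s"
      using x by (auto simp: E_def fin_dom_def)
    then show ?thesis using bound[of x h s] by (simp add: \<psi>_def linear_diff[OF g(1)])
  qed
  moreover obtain x2 where x2: "x2 \<in> C" "G x2 \<noteq> Pinf" "continuous_at_point F x2"
    using reg by (auto simp: regularity2_def effdom_def)
  obtain U m where U: "open U" "x2 \<in> U" "U \<subseteq> fin_dom F" "\<And>x. x \<in> U \<Longrightarrow> g (fin_part (F x)) \<le> m"
    using continuous_at_point_bounded_above[OF x2(3) g(2)] by blast
  moreover have "x2 \<in> E"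
    using x2 G_neq_Minf[of x2] by (cases "G x2") (auto simp: E_def fin_dom_def)
  ultimately obtain r c where r: "linear r" "continuous_on UNIV r"
      "\<And>x. x \<in> fin_dom F \<Longrightarrow> r x + c \<le> g (fin_part (F x))"
      "\<And>x. x \<in> E \<Longrightarrow> - r x - c \<le> \<psi> x"
    using convex_sum_splitting[of "fin_dom F" "\<lambda>x. g (fin_part (F x))" E \<psi> U x2 m] by blast
  show ?thesis
  proof (rule that)
    show "linear (\<lambda>x. r x - g (L x))" by (intro linear_compose_sub r gL)
    show "continuous_on UNIV (\<lambda>x. r x - g (L x))" by (intro continuous_on_diff r gL)
  next
    fix x h assume "F x = Fin h"
    then show "r x - g (L x) - g (h - L x) \<le> - c"
      using r(3)[of x] by (simp add: fin_dom_def linear_diff[OF g(1)])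
  next
    fix x s assume "x \<in> C" "G x = Fin s"
    then show "- (r x - g (L x)) - f s \<le> c - g y"
      using r(4)[of x] by (simp add: E_def fin_dom_def \<psi>_def)
  qed
qed

text \<open>
  With \<open>L' = l k\<close> and \<open>T = f k\<close>, the functional \<open>g\<close> is at most \<open>- c\<close> on the first conjugate and at most \<open>c - g(y)\<close> on
  the second one, hence at most \<open>g(- y)\<close> on their sum.
\<close>
lemma stable_strong_duality2:
  assumes slater: "regularity1 S C F G" and reg: "regularity2 C F G"
  shows "stable_strong_duality K S C F G (dual_set2 K S C F G)"
  unfolding stable_strong_duality_def
proof
  fix L :: "'x \<Rightarrow> 'y" assume L: "L \<in> cont_linear"
  define M where "M = {tilt F L x |x. x \<in> feasible S C G}"
  define A where "A L' = conjugate K (tilt F L) L'" for L'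
  define B where "B L' T = conjugate K (\<lambda>x. ind C x + compose_ext T G x) (\<lambda>x. - L' x)"
    for L' and T :: "'z \<Rightarrow> 'y"
  define I where "I = (cont_linear :: ('x \<Rightarrow> 'y) set) \<times> (pos_cont_linear S K)"
  define W where "W = (\<lambda>(L', T). A L' + B L' T)"
  obtain m where m: "Fin m \<in> M" unfolding M_def using feasible_value_finite .
  have "WInf K M = WMax K (\<Union>i\<in>I. uminus ` WSup K (W i))"
  proof (rule WInf_eq_WMax_if_tight[OF m])
    show "I \<noteq> {}" using L zero_pos_cont_linear by (auto simp: I_def)
  next
    fix i w assume i: "i \<in> I" and w: "w \<in> M" "w \<noteq> Pinf"
    obtain L' T where T: "i = (L', T)" "T \<in> pos_cont_linear S K" using i by (auto simp: I_def)
    obtain x h s where x: "x \<in> C" "F x = Fin h" "G x = Fin (- s)" "s \<in> S" "w = Fin (h - L x)"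
      using feasible_valueE[OF w[unfolded M_def]] .
    obtain a where a: "a \<in> A L'" "cone_le K (Fin (L' x - (h - L x))) a"
      unfolding A_def using conjugate_dominates[of "tilt F L" x "h - L x" L', OF tilt_Fin[OF x(2)]]
      by blast
    have "ind C x + compose_ext T G x = Fin (- T s)"
      using x pos_cont_linearD(1)[OF T(2)] by (simp add: ind_def compose_ext_def)
    then obtain b where b: "b \<in> B L' T" "cone_le K (Fin (- L' x - - T s)) b"
      unfolding B_def
      using conjugate_dominates[of "\<lambda>x. ind C x + compose_ext T G x" x "- T s" "\<lambda>x. - L' x"] by blast
    have "cone_le K (- w) (Fin (L' x - (h - L x)) + Fin (- L' x - - T s))"
      using x(4,5) pos_cont_linearD(2)[OF T(2)] by (simp add: cone_le_def)
    also have "cone_le K \<dots> (a + b)" using a(2) b(2) by (rule cone_le_add) simp_all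
    finally (cone_le_trans) have "cone_le K (- w) (a + b)" .
    moreover have "a + b \<in> W i" using a(1) b(1) by (auto simp: W_def T(1))
    ultimately show "\<exists>b\<in>W i. cone_le K (- w) b" by blast
  next
    fix y assume y: "Fin y \<in> WInf K M"
    obtain g k f where gkf: "normalized_multiplier K S g k f"
      and bound: "\<And>x h s. x \<in> C \<Longrightarrow> F x = Fin h \<Longrightarrow> G x = Fin s \<Longrightarrow> g y \<le> g (h - L x) + f s"
      using lagrange_multiplier[OF L slater y[unfolded M_def]] by blast
    note g = normalized_multiplierD[OF gkf]
    obtain l c where l: "linear l" "continuous_on UNIV l"
      "\<And>x h. F x = Fin h \<Longrightarrow> l x - g (h - L x) \<le> - c"
      "\<And>x s. x \<in> C \<Longrightarrow> G x = Fin s \<Longrightarrow> - l x - f s \<le> c - g y"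
      using objective_splitting[OF L gkf bound reg] by blast
    define L' where "L' x = l x *\<^sub>R k" for x
    define T where "T z = f z *\<^sub>R k" for z
    have gL': "g (L' x) = l x" and gT: "g (T z) = f z" for x z
      unfolding L'_def T_def linear_scale[OF g(1)] g(5) by simp_all
    have A: "scalarly_le g (- c) a" if "a \<in> A L'" for a
    proof (rule conjugate_scalarly_le[OF g(1,2,3,4) _ _ that[unfolded A_def]])
      show "tilt F L x \<noteq> Minf" for x by (cases rule: tilt_cases[of L x]) auto
      show "g (L' x) - g h \<le> - c" if "tilt F L x = Fin h" for x h
        using that l(3)[of x] by (cases rule: tilt_cases[of L x]) (auto simp: gL')
    qed
    have B: "scalarly_le g (c - g y) b" if "b \<in> B L' T" for b
    proof (rule conjugate_scalarly_le[OF g(1,2,3,4) _ _ that[unfolded B_def]])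
      show "ind C x + compose_ext T G x \<noteq> Minf" for x
        by (cases rule: G_cases[of x T]) (auto simp: ind_def)
      show "g (- L' x) - g h \<le> c - g y" if "ind C x + compose_ext T G x = Fin h" for x h
      proof (cases rule: G_cases[of x T])
        case (2 s)
        then have "x \<in> C" "h = T s" using that by (auto simp: ind_def split: if_splits)
        then show ?thesis using l(4)[OF _ 2(1)] by (simp add: linear_neg[OF g(1)] gL' gT)
      qed (use that in \<open>auto simp: ind_def split: if_splits\<close>)
    qed
    have "scalarly_le g (g (- y)) b" if b: "b \<in> W (L', T)" for b
    proof -
      obtain a' b' where ab: "a' \<in> A L'" "b' \<in> B L' T" "b = a' + b'"
        using b by (auto simp: W_def elim: set_plus_elim)
      have "scalarly_le g (- c + (c - g y)) (a' + b')"
        by (intro scalarly_le_add g(1) A B ab)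
      then show ?thesis by (simp add: ab(3) linear_neg[OF g(1)])
    qed
    then have "\<forall>b\<in>W (L', T). \<not> cone_less K (Fin (- y)) b"
      using normalized_multiplier_not_less[OF gkf] by blast
    moreover have "T \<in> pos_cont_linear S K"
      unfolding T_def using normalized_multiplier_pos_cont_linear[OF gkf cone_K] .
    moreover have "L' \<in> cont_linear" unfolding L'_def by (intro rank_one_cont_linear l)
    ultimately show "\<exists>i\<in>I. \<forall>b\<in>W i. \<not> cone_less K (Fin (- y)) b" by (auto simp: I_def)
  qed
  also have "(\<Union>i\<in>I. uminus ` WSup K (W i)) = dual_set2 K S C F G L"
    by (auto simp: I_def W_def A_def B_def dual_set2_def WS_sum_def)
  finally show "WInf K {tilt F L x |x. x \<in> feasible S C G} = WMax K (dual_set2 K S C F G L)"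
    by (simp add: M_def)
qed

text \<open>
  The constraint \<open>f \<circ> G\<close> is now the function that is bounded above near a point, and the affine function \<open>l + c\<close> on
  \<open>C\<close> is the other one. The two conclusions bound \<open>g\<close> on the conjugates of \<open>T \<circ> G\<close> at \<open>r k\<close> and of the indicator of \<open>C\<close> at
  \<open>(- l - r) k\<close>.
\<close>
lemma constraint_splitting:
  assumes gkf: "normalized_multiplier K S g k f"
    and l: "linear l" "\<And>x s. x \<in> C \<Longrightarrow> G x = Fin s \<Longrightarrow> - l x - f s \<le> c"
    and reg: "regularity3 C G"
  obtains r d where "linear r" "continuous_on UNIV r"
    "\<And>x s. G x = Fin s \<Longrightarrow> r x - f s \<le> - d" "\<And>x. x \<in> C \<Longrightarrow> - l x - r x \<le> c + d"
proof -
  have f: "linear f" "continuous_on UNIV f" "\<And>z. z \<in> S \<Longrightarrow> 0 \<le> f z"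
    using gkf by (auto simp: normalized_multiplier_def)
  obtain x3 where x3: "x3 \<in> C" "continuous_at_point G x3"
    using reg by (auto simp: regularity3_def)
  obtain U m where U: "open U" "x3 \<in> U" "U \<subseteq> fin_dom G" "\<And>x. x \<in> U \<Longrightarrow> f (fin_part (G x)) \<le> m"
    using continuous_at_point_bounded_above[OF x3(2) f(2)] by blast
  have "0 \<le> f (fin_part (G x)) + (l x + c)" if "x \<in> fin_dom G \<inter> C" for x
    using that l(2)[of x] by (force simp: fin_dom_def)
  then obtain r d where r: "linear r" "continuous_on UNIV r"
      "\<And>x. x \<in> fin_dom G \<Longrightarrow> r x + d \<le> f (fin_part (G x))"
      "\<And>x. x \<in> C \<Longrightarrow> - r x - d \<le> l x + c"
    using convex_sum_splitting[OF convex_on_scalarization[OF convex_G zero_mem_S f(1,3)]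
        convex_on_affine[OF convex_C l(1)] _ U x3(1)] by blast
  show ?thesis
  proof (rule that[OF r(1,2)])
    show "r x - f s \<le> - d" if "G x = Fin s" for x s
      using r(3)[of x] that by (simp add: fin_dom_def)
    show "- l x - r x \<le> c + d" if "x \<in> C" for x
      using r(4)[OF that] by simp
  qed
qed

text \<open>
  The choice \<open>L'' = (- l - r) k\<close> makes the argument of the third conjugate \<open>r k\<close>. The three bounds \<open>- c\<close>,
  \<open>c - g(y) + d\<close> and \<open>- d\<close> add up to \<open>g(- y)\<close>, where the inner WS-sum keeps the bound of the sum of the first
  two conjugates.
\<close>
lemma stable_strong_duality3:
  assumes slater: "regularity1 S C F G" and reg2: "regularity2 C F G" and reg3: "regularity3 C G"
  shows "stable_strong_duality K S C F G (dual_set3 K S C F G)"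
  unfolding stable_strong_duality_def
proof
  fix L :: "'x \<Rightarrow> 'y" assume L: "L \<in> cont_linear"
  define M where "M = {tilt F L x |x. x \<in> feasible S C G}"
  define A where "A L' = conjugate K (tilt F L) L'" for L'
  define B where "B L'' = conjugate K (ind C) L''" for L'' :: "'x \<Rightarrow> 'y"
  define D where "D L' L'' T = conjugate K (compose_ext T G) (\<lambda>x. - L' x - L'' x)"
    for L' L'' and T :: "'z \<Rightarrow> 'y"
  define I where "I = (cont_linear :: ('x \<Rightarrow> 'y) set) \<times> (cont_linear :: ('x \<Rightarrow> 'y) set)
    \<times> pos_cont_linear S K"
  define W where "W = (\<lambda>(L', L'', T). WSup K (A L' + B L'') + D L' L'' T)"
  obtain m where m: "Fin m \<in> M" unfolding M_def using feasible_value_finite .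
  have "WInf K M = WMax K (\<Union>i\<in>I. uminus ` WSup K (W i))"
  proof (rule WInf_eq_WMax_if_tight[OF m])
    show "I \<noteq> {}" using L zero_pos_cont_linear by (auto simp: I_def)
  next
    fix i w assume i: "i \<in> I" and w: "w \<in> M" "w \<noteq> Pinf"
    obtain L' L'' T where T: "i = (L', L'', T)" "T \<in> pos_cont_linear S K"
      using i by (auto simp: I_def)
    obtain x h s where x: "x \<in> C" "F x = Fin h" "G x = Fin (- s)" "s \<in> S" "w = Fin (h - L x)"
      using feasible_valueE[OF w[unfolded M_def]] .
    obtain a where a: "a \<in> A L'" "cone_le K (Fin (L' x - (h - L x))) a"
      unfolding A_def using conjugate_dominates[of "tilt F L" x "h - L x" L', OF tilt_Fin[OF x(2)]]
      by blast
    obtain b where b: "b \<in> B L''" "cone_le K (Fin (L'' x - 0)) b"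
      unfolding B_def using conjugate_dominates[of "ind C" x 0 L''] x(1) by (auto simp: ind_def)
    have "compose_ext T G x = Fin (- T s)"
      using x pos_cont_linearD(1)[OF T(2)] by (simp add: compose_ext_def)
    then obtain d where d: "d \<in> D L' L'' T" "cone_le K (Fin ((- L' x - L'' x) - - T s)) d"
      unfolding D_def
      using conjugate_dominates[of "compose_ext T G" x "- T s" "\<lambda>x. - L' x - L'' x"] by blast
    have ab: "cone_le K (Fin (L' x - (h - L x)) + Fin (L'' x - 0)) (a + b)"
      using a(2) b(2) by (rule cone_le_add) simp_all
    then have "a + b \<noteq> Minf" by (auto simp: cone_le_def)
    then obtain e where e: "e \<in> WSup K (A L' + B L'')" "cone_le K (a + b) e"
      using WSup_dominates[OF set_plus_intro[OF a(1) b(1)]] by blast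
    have "cone_le K (Fin (L' x - (h - L x)) + Fin (L'' x - 0)) e"
      using ab e(2) by (rule cone_le_trans)
    then have "cone_le K (Fin (L' x - (h - L x)) + Fin (L'' x - 0) + Fin ((- L' x - L'' x) - - T s))
        (e + d)"
      using d(2) by (rule cone_le_add) simp_all
    moreover have "cone_le K (- w)
        (Fin (L' x - (h - L x)) + Fin (L'' x - 0) + Fin ((- L' x - L'' x) - - T s))"
      using x(4,5) pos_cont_linearD(2)[OF T(2)] by (simp add: cone_le_def)
    ultimately have "cone_le K (- w) (e + d)" by (rule cone_le_trans[rotated])
    moreover have "e + d \<in> W i" using e(1) d(1) by (auto simp: W_def T(1))
    ultimately show "\<exists>b\<in>W i. cone_le K (- w) b" by blast
  next
    fix y assume y: "Fin y \<in> WInf K M"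
    obtain g k f where gkf: "normalized_multiplier K S g k f"
      and bound: "\<And>x h s. x \<in> C \<Longrightarrow> F x = Fin h \<Longrightarrow> G x = Fin s \<Longrightarrow> g y \<le> g (h - L x) + f s"
      using lagrange_multiplier[OF L slater y[unfolded M_def]] by blast
    note g = normalized_multiplierD[OF gkf]
    obtain l c where l: "linear l" "continuous_on UNIV l"
      "\<And>x h. F x = Fin h \<Longrightarrow> l x - g (h - L x) \<le> - c"
      "\<And>x s. x \<in> C \<Longrightarrow> G x = Fin s \<Longrightarrow> - l x - f s \<le> c - g y"
      using objective_splitting[OF L gkf bound reg2] by blast
    obtain r d where r: "linear r" "continuous_on UNIV r"
      "\<And>x s. G x = Fin s \<Longrightarrow> r x - f s \<le> - d"
      "\<And>x. x \<in> C \<Longrightarrow> - l x - r x \<le> c - g y + d"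
      using constraint_splitting[OF gkf l(1,4) reg3] by blast
    define L' where "L' x = l x *\<^sub>R k" for x
    define L'' where "L'' x = (- l x - r x) *\<^sub>R k" for x
    define T where "T z = f z *\<^sub>R k" for z
    have gL': "g (L' x) = l x" and gL'': "g (L'' x) = - l x - r x" and gT: "g (T z) = f z" for x z
      unfolding L'_def L''_def T_def linear_scale[OF g(1)] g(5) by simp_all
    have A: "scalarly_le g (- c) a" if "a \<in> A L'" for a
    proof (rule conjugate_scalarly_le[OF g(1,2,3,4) _ _ that[unfolded A_def]])
      show "tilt F L x \<noteq> Minf" for x by (cases rule: tilt_cases[of L x]) auto
      show "g (L' x) - g h \<le> - c" if "tilt F L x = Fin h" for x h
        using that l(3)[of x] by (cases rule: tilt_cases[of L x]) (auto simp: gL')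
    qed
    have B: "scalarly_le g (c - g y + d) b" if "b \<in> B L''" for b
    proof (rule conjugate_scalarly_le[OF g(1,2,3,4) _ _ that[unfolded B_def]])
      show "ind C x \<noteq> (Minf :: 'y extended)" for x by (simp add: ind_def)
      show "g (L'' x) - g h \<le> c - g y + d" if "ind C x = Fin h" for x h
        using that r(4)[of x] by (auto simp: ind_def gL'' linear_0[OF g(1)] split: if_splits)
    qed
    have D: "scalarly_le g (- d) b" if "b \<in> D L' L'' T" for b
    proof (rule conjugate_scalarly_le[OF g(1,2,3,4) _ _ that[unfolded D_def]])
      show "compose_ext T G x \<noteq> Minf" for x by (cases rule: G_cases[of x T]) auto
      show "g (- L' x - L'' x) - g h \<le> - d" if "compose_ext T G x = Fin h" for x h
        using that r(3)[of x] by (cases rule: G_cases[of x T])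
          (auto simp: gL' gL'' gT linear_neg[OF g(1)] linear_diff[OF g(1)])
    qed
    have AB: "scalarly_le g (- c + (c - g y + d)) e" if "e \<in> A L' + B L''" for e
      using that by (rule set_plus_elim) (simp only: scalarly_le_add[OF g(1) A B])
    have AB': "scalarly_le g (- c + (c - g y + d)) e" if "e \<in> WSup K (A L' + B L'')" for e
      using WSup_scalarly_le[OF g(1,2,3,4) AB that] .
    have "scalarly_le g (g (- y)) b" if b: "b \<in> W (L', L'', T)" for b
    proof -
      obtain a' b' where ab: "a' \<in> WSup K (A L' + B L'')" "b' \<in> D L' L'' T" "b = a' + b'"
        using b by (auto simp: W_def elim: set_plus_elim)
      have "scalarly_le g (- c + (c - g y + d) + - d) (a' + b')"
        by (intro scalarly_le_add g(1) AB' D ab)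
      then show ?thesis by (simp add: ab(3) linear_neg[OF g(1)])
    qed
    then have "\<forall>b\<in>W (L', L'', T). \<not> cone_less K (Fin (- y)) b"
      using normalized_multiplier_not_less[OF gkf] by blast
    moreover have "T \<in> pos_cont_linear S K"
      unfolding T_def using normalized_multiplier_pos_cont_linear[OF gkf cone_K] .
    moreover have "L' \<in> cont_linear" unfolding L'_def by (intro rank_one_cont_linear l)
    moreover have "L'' \<in> cont_linear" unfolding L''_def
      by (intro rank_one_cont_linear linear_compose_sub linear_compose_neg continuous_on_diff
          continuous_on_minus l r)
    ultimately show "\<exists>i\<in>I. \<forall>b\<in>W i. \<not> cone_less K (Fin (- y)) b" by (auto simp: I_def)
  qed
  also have "(\<Union>i\<in>I. uminus ` WSup K (W i)) = dual_set3 K S C F G L"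
    by (auto simp: I_def W_def A_def B_def D_def dual_set3_def WS_sum_def) blast
  finally show "WInf K {tilt F L x |x. x \<in> feasible S C G} = WMax K (dual_set3 K S C F G L)"
    by (simp add: M_def)
qed

end

theorem corollary6p1:
  fixes F :: "'x::locally_convex_space \<Rightarrow> 'y::locally_convex_space extended"
    and G :: "'x \<Rightarrow> 'z::locally_convex_space extended"
    and C :: "'x set" and K :: "'y set" and S :: "'z set"
  assumes K: "closed K" "convex K" "cone K" "K \<noteq> UNIV" "interior K \<noteq> {}"
    and S: "closed S" "convex S" "cone S" "S \<noteq> {}"
    and F: "\<And>x. F x \<noteq> Minf" "proper F" "cone_convex K F"
    and G: "\<And>x. G x \<noteq> Minf" "proper G" "cone_convex S G"
    and C: "C \<noteq> {}" "convex C"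
    and feas: "feasible S C G \<inter> effdom F \<noteq> {}"
  shows
    "(regularity1 S C F G \<longrightarrow>
        stable_strong_duality K S C F G (dual_set1 K S C F G)) \<and>
     (regularity1 S C F G \<and> regularity2 C F G \<longrightarrow>
        stable_strong_duality K S C F G (dual_set1 K S C F G) \<and>
        stable_strong_duality K S C F G (dual_set2 K S C F G)) \<and>
     (regularity1 S C F G \<and> regularity2 C F G \<and> regularity3 C G \<longrightarrow>
        stable_strong_duality K S C F G (dual_set1 K S C F G) \<and>
        stable_strong_duality K S C F G (dual_set2 K S C F G) \<and>
        stable_strong_duality K S C F G (dual_set3 K S C F G))"
proof -
  interpret cone_program K S F G C
    by unfold_locales (use K S F G C feas in auto)
  show ?thesis
    using stable_strong_duality1 stable_strong_duality2 stable_strong_duality3 by blast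
qed

end
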